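(* Let $(X,d,\mu)$ be a standard metric measure space. Let $G$ be a locally compact group acting continuously by measure-preserving isometries on $X$. Assume that the action is proper and cocompact. Then $G$ is compactly generated, and the orbit maps $G\to X$, $g\mapsto g x_0$ ($x_0\in X$), are measure-scaling quasi-isometries, where $G$ is equipped with a left Haar measure and a word metric associated to a compact generating set.
   Context: A metric measure space is a triple $(X,d,\mu)$ where $X$ is a locally compact topological space, $\mu$ is a non-trivial locally finite Borel measure, and $d$ is a measurable distance on $X$ (not required to be continuous) whose balls are relatively compact. It is standard if: (a) for all $r\geq 1$ there exist $V_r\geq v_r>0$ with $v_r\leq\mu(B(x,r))\leq V_r$ for all $x\in X$; and (b) for all $x,y\in X$ there is a sequence $x=x_0,\ldots,x_n=y$ with $d(x_{i-1},x_i)\leq 1$ for all $i$ and $d(x,y)=\sum_{i=1}^n d(x_{i-1},x_i)$. A compactly generated locally compact group, with a left Haar measure and the left-invariant word metric of a compact symmetric generating set with non-empty interior, is a standard metric measure space. The action is proper if for every compact $K\subset X$ the set $\{g\in G: gK\cap K\neq\emptyset\}$ is relatively compact, and cocompact if $X=GK$ for some compact $K\subset X$. For $A\subset X$ and $R>0$, $A^{+R}=\{x: d(x,A)\leq R\}$ and $\partial_R A=A^{+R}\cap (X\setminus A)^{+R}$. A subset is thick if it is a union of closed balls of radius $1$. A map $f:X\to Y$ between metric spaces is a quasi-isometry if there are $C\geq 1$, $K\geq 0$ with $\frac1C d(x,y)-K\leq d(f(x),f(y))\leq C d(x,y)+K$ for all $x,y\in X$ and every point of $Y$ is within distance $K$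 of $f(X)$. For $\kappa>0$, a measurable map $f:(X,\mu)\to(Y,\nu)$ between standard metric measure spaces is quasi-$\kappa$-to-one if there is a constant $C>0$ such that $|\kappa\,\nu(A)-\mu(f^{-1}(A))|\leq C\,\nu(\partial_2A)$ for every measurable thick subset $A\subset Y$ of finite measure (with $\nu(\partial_2 A)$ read as outer measure if necessary). A measure-scaling quasi-isometry is a measurable quasi-isometry that is quasi-$\kappa$-to-one for some $\kappa>0$.
   Formalization: The formal theorem adds the hypothesis that compact subsets of X are bounded for d; without it the claim fails (a non-finitely generated discrete group can act as required), and it is necessary for the orbit maps to be quasi-isometries. Locally compact is read as including Hausdorff. *)

theory Defs
  imports "HOL-Analysis.Analysis"
begin

section \<open>Metric measure spaces\<close>

text \<open>
  The underlying set is a whole type carrying a topology, while the distance \<open>d\<close> is an explicit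
  function, in general unrelated to that topology. Locally compact spaces are Hausdorff.
  Measurability of \<open>d\<close> refers to the Borel sets of the product topology, which is in general finer
  than the product of the Borel sigma-algebras.
\<close>

abbreviation closed_ball :: "('x \<Rightarrow> 'x \<Rightarrow> real) \<Rightarrow> 'x \<Rightarrow> real \<Rightarrow> 'x set" where
  "closed_ball d \<equiv> Metric_space.mcball UNIV d"

definition relatively_compact :: "'x::t2_space set \<Rightarrow> bool" where
  "relatively_compact A \<longleftrightarrow> compact (closure A)"

definition locally_finite_borel_measure :: "'x::topological_space measure \<Rightarrow> bool" where
  "locally_finite_borel_measure \<mu> \<longleftrightarrow>
     sets \<mu> = sets borel \<and> (\<forall>x. \<exists>U. open U \<and> x \<in> U \<and> emeasure \<mu> U < \<infinity>)"

definition metric_measure_space :: "('x::t2_space \<Rightarrow> 'x \<Rightarrow> real) \<Rightarrow> 'x measure \<Rightarrow> bool" where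
  "metric_measure_space d \<mu> \<longleftrightarrow>
     locally_compact_space (euclidean :: 'x topology) \<and>
     locally_finite_borel_measure \<mu> \<and>
     emeasure \<mu> (space \<mu>) \<noteq> 0 \<and>
     Metric_space UNIV d \<and>
     (\<lambda>(x, y). d x y) \<in> borel_measurable (borel :: ('x \<times> 'x) measure) \<and>
     (\<forall>x r. relatively_compact (closed_ball d x r))"

definition standard_mm_space :: "('x::t2_space \<Rightarrow> 'x \<Rightarrow> real) \<Rightarrow> 'x measure \<Rightarrow> bool" where
  "standard_mm_space d \<mu> \<longleftrightarrow>
     metric_measure_space d \<mu> \<and>
     (\<forall>r\<ge>1. \<exists>v V :: real. 0 < v \<and> v \<le> V \<and>
        (\<forall>x. ennreal v \<le> emeasure \<mu> (closed_ball d x r) \<and>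
             emeasure \<mu> (closed_ball d x r) \<le> ennreal V)) \<and>
     (\<forall>x y. \<exists>(n::nat) s. s 0 = x \<and> s n = y \<and>
        (\<forall>i<n. d (s i) (s (Suc i)) \<le> 1) \<and>
        d x y = (\<Sum>i<n. d (s i) (s (Suc i))))"

text \<open>The distance to the empty set is infinite, so the thickening of the empty set is empty
  (\<open>infdist\<close> has the other convention).\<close>

definition thickening :: "('x \<Rightarrow> 'x \<Rightarrow> real) \<Rightarrow> real \<Rightarrow> 'x set \<Rightarrow> 'x set" where
  "thickening d R A = {x. A \<noteq> {} \<and> (INF a\<in>A. d x a) \<le> R}"

definition boundary :: "('x \<Rightarrow> 'x \<Rightarrow> real) \<Rightarrow> real \<Rightarrow> 'x set \<Rightarrow> 'x set" where
  "boundary d R A = thickening d R A \<inter> thickening d R (- A)"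

definition thick :: "('x \<Rightarrow> 'x \<Rightarrow> real) \<Rightarrow> 'x set \<Rightarrow> bool" where
  "thick d A \<longleftrightarrow> (\<exists>Z. A = (\<Union>z\<in>Z. closed_ball d z 1))"


section \<open>Measure-scaling quasi-isometries\<close>

definition quasi_isometry ::
  "('x \<Rightarrow> 'x \<Rightarrow> real) \<Rightarrow> ('y \<Rightarrow> 'y \<Rightarrow> real) \<Rightarrow> ('x \<Rightarrow> 'y) \<Rightarrow> bool" where
  "quasi_isometry dX dY f \<longleftrightarrow>
     (\<exists>C K. C \<ge> 1 \<and> K \<ge> 0 \<and>
        (\<forall>x y. 1 / C * dX x y - K \<le> dY (f x) (f y) \<and> dY (f x) (f y) \<le> C * dX x y + K) \<and>
        (\<forall>y. \<exists>x. dY y (f x) \<le> K))"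

text \<open>The source metric does not occur in this notion. The difference of measures is never
  \<open>\<infinity> - \<infinity>\<close>, because \<open>A\<close> has finite measure.\<close>

definition quasi_to_one ::
  "real \<Rightarrow> 'x measure \<Rightarrow> ('y \<Rightarrow> 'y \<Rightarrow> real) \<Rightarrow> 'y measure \<Rightarrow> ('x \<Rightarrow> 'y) \<Rightarrow> bool" where
  "quasi_to_one \<kappa> \<mu> dY \<nu> f \<longleftrightarrow>
     f \<in> measurable \<mu> \<nu> \<and>
     (\<exists>C::real. C > 0 \<and>
        (\<forall>A\<in>sets \<nu>. thick dY A \<and> emeasure \<nu> A < \<infinity> \<longrightarrow>
           \<bar>ereal \<kappa> * enn2ereal (emeasure \<nu> A) - enn2ereal (emeasure \<mu> (f -` A \<inter> space \<mu>))\<bar>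
             \<le> ereal C * enn2ereal (outer_measure_of \<nu> (boundary dY 2 A))))"

definition measure_scaling_quasi_isometry ::
  "('x \<Rightarrow> 'x \<Rightarrow> real) \<Rightarrow> 'x measure \<Rightarrow> ('y \<Rightarrow> 'y \<Rightarrow> real) \<Rightarrow> 'y measure \<Rightarrow> ('x \<Rightarrow> 'y) \<Rightarrow> bool" where
  "measure_scaling_quasi_isometry dX \<mu> dY \<nu> f \<longleftrightarrow>
     f \<in> measurable \<mu> \<nu> \<and> quasi_isometry dX dY f \<and> (\<exists>\<kappa>>0. quasi_to_one \<kappa> \<mu> dY \<nu> f)"


section \<open>Locally compact groups\<close>

text \<open>
  A topological group is a type of class \<^class>\<open>topological_group_add\<close>: the group operation is written
  additively, but commutativity is not assumed.
\<close>

definition generates :: "'g::group_add set \<Rightarrow> bool" where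
  "generates S \<longleftrightarrow> (\<forall>g. \<exists>ws. set ws \<subseteq> S \<union> uminus ` S \<and> sum_list ws = g)"

definition word_length :: "'g::group_add set \<Rightarrow> 'g \<Rightarrow> nat" where
  "word_length S g =
     (LEAST n. \<exists>ws. length ws = n \<and> set ws \<subseteq> S \<union> uminus ` S \<and> sum_list ws = g)"

definition word_metric :: "'g::group_add set \<Rightarrow> 'g \<Rightarrow> 'g \<Rightarrow> real" where
  "word_metric S g h = real (word_length S (- g + h))"

text \<open>Left Haar measures: nonzero left-invariant Radon measures.\<close>

definition left_haar_measure :: "'g::{topological_group_add, t2_space} measure \<Rightarrow> bool" where
  "left_haar_measure l \<longleftrightarrow>
     sets l = sets borel \<and>
     emeasure l (space l) \<noteq> 0 \<and>
     (\<forall>g. \<forall>A\<in>sets l. emeasure l ((+) g ` A) = emeasure l A) \<and>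
     (\<forall>K. compact K \<longrightarrow> emeasure l K < \<infinity>) \<and>
     (\<forall>A\<in>sets l. emeasure l A = (INF U\<in>{U. open U \<and> A \<subseteq> U}. emeasure l U)) \<and>
     (\<forall>U. open U \<longrightarrow> emeasure l U = (SUP K\<in>{K. compact K \<and> K \<subseteq> U}. emeasure l K))"

definition continuous_group_action ::
  "('g::{topological_group_add, t2_space} \<Rightarrow> 'x::t2_space \<Rightarrow> 'x) \<Rightarrow> bool" where
  "continuous_group_action act \<longleftrightarrow>
     (\<forall>x. act 0 x = x) \<and>
     (\<forall>g h x. act (g + h) x = act g (act h x)) \<and>
     continuous_on UNIV (\<lambda>(g, x). act g x)"

definition acts_by_mp_isometries ::
  "('g \<Rightarrow> 'x \<Rightarrow> 'x) \<Rightarrow> ('x \<Rightarrow> 'x \<Rightarrow> real) \<Rightarrow> 'x measure \<Rightarrow> bool" where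
  "acts_by_mp_isometries act d \<mu> \<longleftrightarrow>
     (\<forall>g x y. d (act g x) (act g y) = d x y) \<and>
     (\<forall>g. act g \<in> measurable \<mu> \<mu> \<and> distr \<mu> \<mu> (act g) = \<mu>)"

definition proper_action ::
  "('g::t2_space \<Rightarrow> 'x::t2_space \<Rightarrow> 'x) \<Rightarrow> bool" where
  "proper_action act \<longleftrightarrow>
     (\<forall>K. compact K \<longrightarrow> relatively_compact {g. act g ` K \<inter> K \<noteq> {}})"

definition cocompact_action :: "('g \<Rightarrow> 'x::t2_space \<Rightarrow> 'x) \<Rightarrow> bool" where
  "cocompact_action act \<longleftrightarrow> (\<exists>K. compact K \<and> (\<Union>g. act g ` K) = UNIV)"

text \<open>
  Compatibility of the distance with the topology: compact sets are bounded, which is the converse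
  of balls being relatively compact. It holds for word metrics and for all continuous distances.
  It does not follow from the other axioms of a standard metric measure space, and without it a
  group acting properly and cocompactly by measure-preserving isometries need not be compactly
  generated. Let \<open>G\<close> be the discrete direct sum of countably many copies of \<open>\<int>/2\<close>, \<open>G\<^sub>k\<close> the sum of
  the first \<open>k\<close> copies, and \<open>X = G \<times> (\<nat> \<union> {\<infinity>})\<close> with \<open>G\<close> translating the first factor; give
  \<open>(g, k)\<close> the mass \<open>2\<close> to the power \<open>-k\<close>. For distinct points and the least \<open>m \<ge> max k l\<close>
  with \<open>g + G\<^sub>m = h + G\<^sub>m\<close>, let \<open>d (g, k) (h, l) = max 1 (2 m - k - l)\<close>, and attach \<open>(g, \<infinity>)\<close>,
  of mass \<open>0\<close>, to \<open>(g, 0)\<close> by an edge of length \<open>1\<close>.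
\<close>

definition compact_sets_bounded :: "('x::t2_space \<Rightarrow> 'x \<Rightarrow> real) \<Rightarrow> bool" where
  "compact_sets_bounded d \<longleftrightarrow> (\<forall>K. compact K \<longrightarrow> Metric_space.mbounded UNIV d K)"

end

theory Submission
  imports Defs
begin

text \<open>
  The proof combines the argument of Milnor and Schwarz with an averaging argument over the group.

  Coarse geometry. Every point of \<open>X\<close> is within some \<open>D\<close> of the orbit of \<open>x0\<close>. A geodesic chain from
  \<open>g \<cdot> x0\<close> to \<open>h \<cdot> x0\<close> can be thinned out so that its number of steps is comparable to the distance
  (\<open>intermediate_point\<close>); replacing its points by nearby orbit points writes \<open>- g + h\<close> as a word of comparable
  length in the elements that move \<open>x0\<close> by at most \<open>2 * D + 2\<close> (\<open>orbit_word\<close>). By properness these form a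
  relatively compact set, so \<open>G\<close> is compactly generated. For an arbitrary compact generating set \<open>S\<close>,
  Baire's theorem bounds the word length on this relatively compact set
  (\<open>word_length_bounded_on_compact\<close>), and the orbit map is a quasi-isometry.

  Measure. A continuous bump function on \<open>X\<close>, divided by the function of its orbital integrals, gives a
  function \<open>H \<ge> 0\<close> of bounded support such that \<open>\<integral> H (- g \<cdot> x) dg = 1\<close> for every \<open>x\<close>. By Fubini's theorem
  \<open>\<mu> A\<close> is the integral over \<open>g\<close> of \<open>\<integral>\<^sub>A H (- g \<cdot> x) d\<mu>\<close> (\<open>exists_averaging_function\<close>). The inner integral is
  the constant \<open>c = \<integral> H d\<mu>\<close> if \<open>g \<cdot> x0\<close> is deep inside \<open>A\<close>, and \<open>0\<close> if it is far outside. Hence \<open>\<mu> A\<close> agrees with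
  \<open>c\<close> times the Haar measure of the preimage of \<open>A\<close> up to the contribution of a neighbourhood of the
  boundary of \<open>A\<close>. A maximal separated set in the \<open>2\<close>-boundary (\<open>crossing_point\<close>, \<open>separated_net\<close>) bounds this
  contribution by the outer measure of the \<open>2\<close>-boundary.

  The spaces need not be second countable and \<open>\<mu>\<close> need not be regular, so Borel sets of \<open>G \<times> X\<close> can fail to be
  measurable for the product sigma-algebra. This is why the averaging function is built from a
  continuous one: continuous functions on products of \<open>\<sigma>\<close>-compact spaces are measurable for the product
  sigma-algebra (\<open>continuous_pair_borel_measurable\<close>).
\<close>

section \<open>Locally compact spaces and groups\<close>

lemma Hausdorff_space_t2: "Hausdorff_space (euclidean :: 'a::t2_space topology)"
  unfolding Hausdorff_space_def disjnt_def by (simp, metis hausdorff)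

lemma locally_compact_nbhdE:
  fixes x :: "'a::t2_space"
  assumes "locally_compact_space (euclidean :: 'a topology)"
  obtains U K where "open U" "compact K" "x \<in> U" "U \<subseteq> K"
  using assms unfolding locally_compact_space_def by auto metis

lemma relatively_compact_subset:
  assumes "compact K" "A \<subseteq> K"
  shows "relatively_compact A"
  unfolding relatively_compact_def
  using assms by (metis closed_closure closure_minimal compact_Int_closed compact_imp_closed inf.absorb2)

lemma open_left_translate:
  fixes U :: "'g::topological_group_add set"
  assumes "open U"
  shows "open ((+) g ` U)"
proof -
  have "(+) g ` U = (\<lambda>h. - g + h) -` U"
    by (force simp: image_iff add.assoc[symmetric])
  moreover have "open ((\<lambda>h. - g + h) -` U)"
    by (intro open_vimage assms continuous_intros)
  ultimately show ?thesis by simp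
qed

section \<open>Words in a compact generating set\<close>

definition word_ball :: "'g::group_add set \<Rightarrow> nat \<Rightarrow> 'g set" where
  "word_ball S n = {sum_list ws | ws. set ws \<subseteq> S \<union> uminus ` S \<and> length ws \<le> n}"

lemma word_ball_0: "word_ball S 0 = {0}"
  unfolding word_ball_def by auto

lemma word_ball_Suc:
  "word_ball S (Suc n) = insert 0 {a + b | a b. a \<in> S \<union> uminus ` S \<and> b \<in> word_ball S n}"
    (is "_ = ?R")
proof (intro set_eqI iffI)
  fix g assume "g \<in> word_ball S (Suc n)"
  then obtain ws where ws: "g = sum_list ws" "set ws \<subseteq> S \<union> uminus ` S" "length ws \<le> Suc n"
    unfolding word_ball_def by blast
  show "g \<in> ?R"
  proof (cases ws)
    case (Cons a us)
    then have "sum_list us \<in> word_ball S n" "a \<in> S \<union> uminus ` S" "g = a + sum_list us"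
      using ws unfolding word_ball_def by auto
    then show ?thesis by blast
  qed (use ws in simp)
next
  fix g assume "g \<in> ?R"
  then consider "g = 0" | a b where "a \<in> S \<union> uminus ` S" "g = a + b" "b \<in> word_ball S n"
    by blast
  then show "g \<in> word_ball S (Suc n)"
  proof cases
    case 1 then show ?thesis unfolding word_ball_def by (intro CollectI exI[of _ "[]"]) simp
  next
    case 2
    then obtain ws where "set ws \<subseteq> S \<union> uminus ` S" "length ws \<le> n" "b = sum_list ws"
      unfolding word_ball_def by blast
    with 2 show ?thesis
      unfolding word_ball_def by (intro CollectI exI[of _ "a # ws"]) simp
  qed
qed

lemma compact_word_ball:
  fixes S :: "'g::topological_group_add set"
  assumes "compact S"
  shows "compact (word_ball S n)"
proof (induction n)
  case 0 show ?case by (simp add: word_ball_0)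
next
  case (Suc n)
  have "compact (uminus ` S)"
    by (intro compact_continuous_image assms continuous_intros)
  then have "compact ((S \<union> uminus ` S) \<times> word_ball S n)"
    using assms Suc by (intro compact_Times compact_Un)
  then have cpt: "compact ((\<lambda>(a, b). a + b) ` ((S \<union> uminus ` S) \<times> word_ball S n))"
    by (rule compact_continuous_image[rotated]) (auto simp: case_prod_unfold intro!: continuous_intros)
  have eq: "{a + b | a b. a \<in> A \<and> b \<in> B} = (\<lambda>(a, b). a + b) ` (A \<times> B)" for A B :: "'g set"
    by auto
  show ?case unfolding word_ball_Suc eq using cpt by (rule compact_insert)
qed

lemma word_length_le_iff:
  assumes "generates S"
  shows "word_length S g \<le> n \<longleftrightarrow> g \<in> word_ball S n"
proof
  let ?P = "\<lambda>n. \<exists>ws. length ws = n \<and> set ws \<subseteq> S \<union> uminus ` S \<and> sum_list ws = g"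
  have "\<exists>n. ?P n" using assms unfolding generates_def by blast
  then have P: "?P (word_length S g)"
    unfolding word_length_def by (rule LeastI_ex)
  show "g \<in> word_ball S n" if "word_length S g \<le> n"
  proof -
    obtain ws where ws: "length ws = word_length S g" "set ws \<subseteq> S \<union> uminus ` S" "sum_list ws = g"
      using P by blast
    then have "length ws \<le> n" using that by simp
    with ws(2,3) show ?thesis unfolding word_ball_def by blast
  qed
  show "word_length S g \<le> n" if "g \<in> word_ball S n"
  proof -
    obtain ws where ws: "g = sum_list ws" "set ws \<subseteq> S \<union> uminus ` S" "length ws \<le> n"
      using \<open>g \<in> word_ball S n\<close> unfolding word_ball_def by blast
    then have "word_length S g \<le> length ws"
      unfolding word_length_def by (intro Least_le) blast
    with ws show ?thesis by simp
  qed
qed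

lemma word_length_obtain:
  assumes "generates S"
  obtains ws where "length ws = word_length S g" "set ws \<subseteq> S \<union> uminus ` S" "sum_list ws = g"
proof -
  have "\<exists>n ws. length ws = n \<and> set ws \<subseteq> S \<union> uminus ` S \<and> sum_list ws = g"
    using assms unfolding generates_def by blast
  from LeastI_ex[OF this] show ?thesis
    using that unfolding word_length_def by blast
qed

lemma word_length_sum_list_le:
  assumes "generates S" "set ws \<subseteq> S \<union> uminus ` S"
  shows "word_length S (sum_list ws) \<le> length ws"
  using assms(2) unfolding word_length_le_iff[OF assms(1)] word_ball_def by blast

lemma word_length_eq_0_iff:
  assumes "generates S"
  shows "word_length S g = 0 \<longleftrightarrow> g = 0"
  using word_length_le_iff[OF assms, of g 0] by (simp add: word_ball_0)

lemma word_length_add_le: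
  assumes "generates S"
  shows "word_length S (g + h) \<le> word_length S g + word_length S h"
proof -
  obtain us where us: "length us = word_length S g" "set us \<subseteq> S \<union> uminus ` S" "sum_list us = g"
    using word_length_obtain[OF assms] .
  obtain vs where vs: "length vs = word_length S h" "set vs \<subseteq> S \<union> uminus ` S" "sum_list vs = h"
    using word_length_obtain[OF assms] .
  show ?thesis
    using word_length_sum_list_le[OF assms, of "us @ vs"] us vs by simp
qed

lemma minus_sum_list: "- sum_list ws = sum_list (map uminus (rev ws))"
  for ws :: "'g::group_add list"
  by (induction ws) (auto simp: minus_add)

lemma word_length_minus:
  assumes "generates S"
  shows "word_length S (- g) = word_length S g"
proof -
  have le: "word_length S (- g) \<le> word_length S g" for g
  proof -
    obtain ws where ws: "length ws = word_length S g" "set ws \<subseteq> S \<union> uminus ` S" "sum_list ws = g"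
      using word_length_obtain[OF assms] .
    have "set (map uminus (rev ws)) \<subseteq> S \<union> uminus ` S"
      using ws(2) by force
    from word_length_sum_list_le[OF assms this] show ?thesis
      using ws by (simp add: minus_sum_list[symmetric])
  qed
  show ?thesis using le[of g] le[of "- g"] by simp
qed

lemma Metric_space_word_metric:
  assumes "generates S"
  shows "Metric_space UNIV (word_metric S)"
proof
  fix x y z :: 'a
  show "0 \<le> word_metric S x y" by (simp add: word_metric_def)
  show "word_metric S x y = word_metric S y x"
    using word_length_minus[OF assms, of "- x + y"] by (simp add: word_metric_def minus_add)
  have "- x + y = 0 \<longleftrightarrow> x = y" by (metis add_minus_cancel add.right_neutral left_minus)
  then show "word_metric S x y = 0 \<longleftrightarrow> x = y"
    by (simp add: word_metric_def word_length_eq_0_iff[OF assms])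
  show "word_metric S x z \<le> word_metric S x y + word_metric S y z"
    using word_length_add_le[OF assms, of "- x + y" "- y + z"]
    by (simp add: word_metric_def add.assoc)
qed

text \<open>The partial sums of a word of minimal length form a geodesic: each step has length at most
  \<open>1\<close>, and the steps cannot add up to more than the length of the word.\<close>

lemma word_metric_chain:
  assumes "generates S"
  shows "\<exists>(n::nat) s. s 0 = x \<and> s n = y \<and> (\<forall>i<n. word_metric S (s i) (s (Suc i)) \<le> 1) \<and>
           word_metric S x y = (\<Sum>i<n. word_metric S (s i) (s (Suc i)))"
proof -
  interpret Metric_space UNIV "word_metric S" by (rule Metric_space_word_metric[OF assms])
  obtain ws where ws: "length ws = word_length S (- x + y)" "set ws \<subseteq> S \<union> uminus ` S"
      "sum_list ws = - x + y"
    using word_length_obtain[OF assms] .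
  define s where "s i = x + sum_list (take i ws)" for i
  let ?n = "length ws"
  have step: "word_metric S (s i) (s (Suc i)) \<le> 1" if "i < ?n" for i
  proof -
    have "- s i + s (Suc i) = sum_list [ws ! i]"
      unfolding s_def take_Suc_conv_app_nth[OF that] sum_list.append minus_add add.assoc by simp
    moreover have "ws ! i \<in> S \<union> uminus ` S"
      using ws(2) that nth_mem by blast
    ultimately show ?thesis
      using word_length_sum_list_le[OF assms, of "[ws ! i]"]
      by (simp add: word_metric_def)
  qed
  have polygon: "word_metric S (s 0) (s n) \<le> (\<Sum>i<n. word_metric S (s i) (s (Suc i)))" for n
  proof (induction n)
    case (Suc n)
    then show ?case using triangle[of "s 0" "s n" "s (Suc n)"] by simp
  qed simp
  have ends: "s 0 = x" "s ?n = y"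
    using ws(3) by (simp_all add: s_def)
  have "(\<Sum>i<?n. word_metric S (s i) (s (Suc i))) \<le> (\<Sum>i<?n. 1)"
    by (intro sum_mono) (simp add: step)
  also have "\<dots> = word_metric S x y" by (simp add: word_metric_def ws)
  finally have "word_metric S x y = (\<Sum>i<?n. word_metric S (s i) (s (Suc i)))"
    using polygon[of ?n] unfolding ends by linarith
  with ends step show ?thesis by (intro exI[of _ ?n] exI[of _ s]) simp
qed

text \<open>A compact generating set may have empty interior, so compactness does not bound word length
  outright. By Baire's theorem some word ball has interior, and finitely many translates of
  that interior cover a given compact set.\<close>

lemma word_length_bounded_on_compact:
  fixes S :: "'g::{topological_group_add, t2_space} set"
  assumes lc: "locally_compact_space (euclidean :: 'g topology)"
    and S: "compact S" "generates S" and Q: "compact Q"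
  obtains T where "\<And>q. q \<in> Q \<Longrightarrow> word_length S q \<le> T"
proof -
  have "\<exists>n. interior (word_ball S n) \<noteq> {}"
  proof (rule ccontr)
    assume "\<nexists>n. interior (word_ball S n) \<noteq> {}"
    then have "euclidean interior_of (\<Union>(range (word_ball S))) = {}"
      using lc locally_compact_Hausdorff_imp_regular_space[OF lc Hausdorff_space_t2]
      by (intro Baire_category_alt)
        (auto intro!: compact_imp_closed compact_word_ball S simp: closed_closedin[symmetric])
    moreover have "g \<in> word_ball S (word_length S g)" for g
      by (simp add: word_length_le_iff[OF S(2), symmetric])
    then have "(\<Union>(range (word_ball S))) = UNIV" by blast
    ultimately show False by simp
  qed
  then obtain n u where u: "u \<in> interior (word_ball S n)" by blast
  define U where "U = interior (word_ball S n)"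
  \<comment> \<open>Translating by \<open>q - u\<close> moves the interior point \<open>u\<close> to \<open>q\<close>.\<close>
  have cover: "q \<in> (+) (q - u) ` U" for q
    using u unfolding U_def by (intro image_eqI[of _ _ u]) auto
  have opn: "\<And>q. q \<in> Q \<Longrightarrow> open ((+) (q - u) ` U)"
    unfolding U_def by (intro open_left_translate open_interior)
  have sub: "Q \<subseteq> (\<Union>q\<in>Q. (+) (q - u) ` U)" using cover by blast
  obtain F where "F \<subseteq> Q" and F: "finite F" "Q \<subseteq> (\<Union>q\<in>F. (+) (q - u) ` U)"
    by (rule compactE_image[OF Q opn sub])
  show ?thesis
  proof (rule that)
    fix q assume "q \<in> Q"
    then obtain p v where p: "p \<in> F" "v \<in> U" "q = (p - u) + v"
      using F(2) by auto
    have "v \<in> word_ball S n" using p(2) interior_subset unfolding U_def by blast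
    then have "word_length S q \<le> word_length S (p - u) + n"
      using word_length_add_le[OF S(2), of "p - u" v] word_length_le_iff[OF S(2), of v n] p(3) by simp
    also have "word_length S (p - u) \<le> (\<Sum>p\<in>F. word_length S (p - u))"
      using p(1) F(1) by (intro member_le_sum) auto
    finally show "word_length S q \<le> (\<Sum>p\<in>F. word_length S (p - u)) + n" by simp
  qed
qed

section \<open>Haar measure and the word metric\<close>

lemma left_haar_measureD:
  assumes "left_haar_measure l"
  shows "sets l = sets borel" "emeasure l (space l) \<noteq> 0"
    "\<And>g A. A \<in> sets l \<Longrightarrow> emeasure l ((+) g ` A) = emeasure l A"
    "\<And>K. compact K \<Longrightarrow> emeasure l K < \<infinity>"
  using assms unfolding left_haar_measure_def by auto

text \<open>Finitely many translates of a nonempty open set cover any compact set, so an open null set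
  would make every compact set null, and by inner regularity the whole group.\<close>

lemma left_haar_measure_open_pos:
  fixes l :: "'g::{topological_group_add, t2_space} measure"
  assumes l: "left_haar_measure l" and U: "open U" "U \<noteq> {}"
  shows "0 < emeasure l U"
proof (rule ccontr)
  assume "\<not> 0 < emeasure l U"
  then have U0: "emeasure l U = 0" by simp
  have sets: "sets l = sets borel" and space: "space l = UNIV"
    using l sets_eq_imp_space_eq[of l borel] unfolding left_haar_measure_def by auto
  obtain u where u: "u \<in> U" using U by blast
  have "emeasure l K = 0" if K: "compact K" for K
  proof -
    have opn: "\<And>g. g \<in> K \<Longrightarrow> open ((+) (g - u) ` U)" by (intro open_left_translate U)
    have "g \<in> (+) (g - u) ` U" for g using u by (intro image_eqI[of _ _ u]) auto
    then have sub: "K \<subseteq> (\<Union>g\<in>K. (+) (g - u) ` U)" by blast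
    obtain F where "F \<subseteq> K" and F: "finite F" "K \<subseteq> (\<Union>g\<in>F. (+) (g - u) ` U)"
      by (rule compactE_image[OF K opn sub])
    have meas: "(+) g ` U \<in> sets l" for g by (simp add: sets open_left_translate U)
    have "emeasure l K \<le> emeasure l (\<Union>g\<in>F. (+) (g - u) ` U)"
      using F meas by (intro emeasure_mono) auto
    also have "\<dots> \<le> (\<Sum>g\<in>F. emeasure l ((+) (g - u) ` U))"
      using F meas by (intro emeasure_subadditive_finite) auto
    also have "\<dots> = 0"
      using l U0 U sets unfolding left_haar_measure_def by (intro sum.neutral) (metis borel_open)
    finally show ?thesis by simp
  qed
  then have "(SUP K\<in>{K. compact K \<and> K \<subseteq> UNIV}. emeasure l K) = 0"
    by (intro antisym SUP_least) auto
  with l space show False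
    unfolding left_haar_measure_def by (metis open_UNIV)
qed

lemma left_haar_measure_distr:
  fixes l :: "'g::{topological_group_add, t2_space} measure"
  assumes "left_haar_measure l"
  shows "distr l l ((+) g) = l"
proof (rule measure_eqI)
  have sets: "sets l = sets borel" and space: "space l = UNIV"
    using assms sets_eq_imp_space_eq[of l borel] unfolding left_haar_measure_def by auto
  have meas: "(+) g \<in> measurable l l"
    by (simp cong: measurable_cong_sets add: sets)
      (intro borel_measurable_continuous_onI continuous_intros)
  fix A assume "A \<in> sets (distr l l ((+) g))"
  then have A: "A \<in> sets l" by simp
  have "(+) g -` A \<inter> space l = (+) (- g) ` A"
    by (force simp: space image_iff add.assoc[symmetric])
  then show "emeasure (distr l l ((+) g)) A = emeasure l A"
    using assms A meas unfolding left_haar_measure_def by (simp add: emeasure_distr)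
qed simp

lemma closed_ball_word_metric:
  assumes "generates S"
  shows "closed_ball (word_metric S) x r = (if r < 0 then {} else (+) x ` word_ball S (nat \<lfloor>r\<rfloor>))"
proof -
  interpret Metric_space UNIV "word_metric S" by (rule Metric_space_word_metric[OF assms])
  have "y \<in> closed_ball (word_metric S) x r \<longleftrightarrow> - x + y \<in> word_ball S (nat \<lfloor>r\<rfloor>)" if "r \<ge> 0" for y
    using that by (simp add: word_metric_def word_length_le_iff[OF assms, symmetric] le_nat_floor
        le_nat_iff le_floor_iff)
  moreover have "- x + y \<in> A \<longleftrightarrow> y \<in> (+) x ` A" for y A
    by (force simp: image_iff add.assoc[symmetric])
  moreover have "closed_ball (word_metric S) x r = {}" if "r < 0"
    using that by (simp add: mcball_eq_empty)
  ultimately show ?thesis by auto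
qed

text \<open>Balls are translates of the compact word balls, so their measures depend on the radius only; the
  hypothesis on the interior makes these measures positive. The distance is Borel because its
  sublevel sets are preimages of word balls under the continuous map \<open>(x, y) \<mapsto> - x + y\<close>.\<close>

proposition standard_mm_space_word_metric:
  fixes S :: "'g::{topological_group_add, t2_space} set"
  assumes lc: "locally_compact_space (euclidean :: 'g topology)"
    and S: "compact S" "generates S" "interior S \<noteq> {}" and l: "left_haar_measure l"
  shows "standard_mm_space (word_metric S) l"
proof -
  interpret Metric_space UNIV "word_metric S" by (rule Metric_space_word_metric[OF S(2)])
  have sets: "sets l = sets borel" and l0: "emeasure l (space l) \<noteq> 0"
    and inv: "\<And>g A. A \<in> sets borel \<Longrightarrow> emeasure l ((+) g ` A) = emeasure l A"
    and fin: "\<And>K. compact K \<Longrightarrow> emeasure l K < \<infinity>"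
    using l unfolding left_haar_measure_def by auto
  have compact_ball: "compact (closed_ball (word_metric S) x r)" for x r
    unfolding closed_ball_word_metric[OF S(2)]
    by (auto intro!: compact_continuous_image continuous_intros compact_word_ball S)
  have "locally_finite_borel_measure l"
    unfolding locally_finite_borel_measure_def
  proof (intro conjI allI sets)
    fix x :: 'g
    obtain U K where "open U" "compact K" "x \<in> U" "U \<subseteq> K" using locally_compact_nbhdE[OF lc] .
    moreover from this have "emeasure l U \<le> emeasure l K"
      by (intro emeasure_mono) (auto simp: sets compact_imp_closed)
    ultimately show "\<exists>U. open U \<and> x \<in> U \<and> emeasure l U < \<infinity>"
      using fin[of K] by (metis le_less_trans)
  qed
  moreover have "(\<lambda>(x, y). word_metric S x y) \<in> borel_measurable borel"
  proof (rule borel_measurableI_le)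
    fix a :: real
    have "closed ((\<lambda>p. - fst p + snd p) -` word_ball S (nat \<lfloor>a\<rfloor>))"
      by (intro closed_vimage compact_imp_closed compact_word_ball S continuous_intros)
    moreover have "{p. (\<lambda>(x, y). word_metric S x y) p \<le> a} =
        (if a < 0 then {} else (\<lambda>p. - fst p + snd p) -` word_ball S (nat \<lfloor>a\<rfloor>))"
      by (auto simp: word_metric_def word_length_le_iff[OF S(2), symmetric] le_nat_floor
        le_nat_iff le_floor_iff)
    ultimately show "{p \<in> space borel. (\<lambda>(x, y). word_metric S x y) p \<le> a} \<in> sets borel"
      by simp
  qed
  ultimately have mm: "metric_measure_space (word_metric S) l"
    unfolding metric_measure_space_def
    using lc l0 compact_ball Metric_space_word_metric[OF S(2)]
    by (auto simp: relatively_compact_def closure_closed compact_imp_closed)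
  have "\<exists>v V. 0 < v \<and> v \<le> V \<and> (\<forall>x. ennreal v \<le> emeasure l (closed_ball (word_metric S) x r) \<and>
             emeasure l (closed_ball (word_metric S) x r) \<le> ennreal V)" if r: "r \<ge> 1" for r :: real
  proof -
    let ?B = "word_ball S (nat \<lfloor>r\<rfloor>)"
    have "s \<in> ?B" if "s \<in> S" for s
      using that r by (auto simp: word_ball_def le_nat_iff intro!: exI[of _ "[s]"])
    then have "interior S \<subseteq> ?B" using interior_subset by blast
    moreover have B: "compact ?B" by (intro compact_word_ball S)
    ultimately have "emeasure l (interior S) \<le> emeasure l ?B"
      by (intro emeasure_mono) (auto simp: sets compact_imp_closed)
    then have "0 < emeasure l ?B"
      using left_haar_measure_open_pos[OF l _ S(3)] by (simp add: order_less_le_trans)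
    moreover have "emeasure l (closed_ball (word_metric S) x r) = emeasure l ?B" for x
      using r B by (simp add: closed_ball_word_metric[OF S(2)] inv compact_imp_closed)
    ultimately show ?thesis
      using fin[OF B]
      by (intro exI[of _ "enn2real (emeasure l ?B)"]) (auto simp: enn2real_positive_iff less_top)
  qed
  with mm word_metric_chain[OF S(2)] show ?thesis
    unfolding standard_mm_space_def by blast
qed

section \<open>Continuous functions on products\<close>

text \<open>The Borel sets of a product of two spaces need not belong to the product of the Borel
  sigma-algebras, but continuous functions on a product of compact spaces are still measurable
  for the latter: locally in the first variable, \<open>f\<close> is uniformly close to a function of
  the second variable alone.\<close>

lemma continuous_pair_borel_measurable_compact:
  fixes f :: "'a::t2_space \<times> 'b::t2_space \<Rightarrow> real"
  assumes f: "continuous_on UNIV f" and K: "compact K" and L: "compact L"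
  shows "(\<lambda>p. f p * indicator (K \<times> L) p) \<in> borel_measurable (borel \<Otimes>\<^sub>M borel)"
proof -
  have slice: "(\<lambda>p. f (k, snd p)) \<in> borel_measurable (borel \<Otimes>\<^sub>M borel)" for k
  proof -
    have "continuous_on UNIV (\<lambda>y. f (k, y))"
      by (rule continuous_on_compose2[OF f]) (auto intro!: continuous_intros)
    then have "(\<lambda>y. f (k, y)) \<in> borel_measurable borel"
      by (rule borel_measurable_continuous_onI)
    from measurable_compose[OF measurable_snd this] show ?thesis .
  qed
  have approx: "\<exists>g \<in> borel_measurable (borel \<Otimes>\<^sub>M borel).
      \<forall>x\<in>K. \<forall>y\<in>L. \<bar>g (x, y) - f (x, y)\<bar> \<le> \<epsilon>" if "\<epsilon> > 0" for \<epsilon> :: real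
  proof -
    have "\<exists>U. k \<in> U \<and> open U \<and> (\<forall>x\<in>U. \<forall>y\<in>L. \<bar>f (k, y) - f (x, y)\<bar> \<le> \<epsilon>)" for k
    proof -
      have "continuous_on (UNIV \<times> L) f" using f continuous_on_subset by blast
      then obtain U where "k \<in> U" "open U" "\<forall>x\<in>U \<inter> UNIV. \<forall>y\<in>L. dist (f (x, y)) (f (k, y)) \<le> \<epsilon>"
        using continuous_on_prod_compactE[of UNIV L f k \<epsilon>] L \<open>\<epsilon> > 0\<close> by (metis UNIV_I)
      then show ?thesis by (auto simp: dist_real_def abs_minus_commute)
    qed
    then obtain U where U: "\<And>k. k \<in> U k" "\<And>k. open (U k)"
      "\<And>k x y. x \<in> U k \<Longrightarrow> y \<in> L \<Longrightarrow> \<bar>f (k, y) - f (x, y)\<bar> \<le> \<epsilon>" by metis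
    have sub: "K \<subseteq> (\<Union>k\<in>K. U k)" using U(1) by blast
    obtain F where "F \<subseteq> K" and F: "finite F" "K \<subseteq> (\<Union>k\<in>F. U k)"
      by (rule compactE_image[OF K U(2) sub])
    have "\<exists>g \<in> borel_measurable (borel \<Otimes>\<^sub>M borel).
        \<forall>x\<in>(\<Union>k\<in>F. U k). \<forall>y\<in>L. \<bar>g (x, y) - f (x, y)\<bar> \<le> \<epsilon>"
      using F(1)
    proof (induction F)
      case empty
      show ?case by (intro bexI[of _ "\<lambda>_. 0"]) auto
    next
      case (insert k F)
      then obtain g where g: "g \<in> borel_measurable (borel \<Otimes>\<^sub>M borel)"
        "\<forall>x\<in>(\<Union>k\<in>F. U k). \<forall>y\<in>L. \<bar>g (x, y) - f (x, y)\<bar> \<le> \<epsilon>" by blast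
      let ?g = "\<lambda>p. if fst p \<in> U k then f (k, snd p) else g p"
      have "Measurable.pred (borel \<Otimes>\<^sub>M borel) (\<lambda>p :: 'a \<times> 'b. fst p \<in> U k)"
        using U(2) by (intro measurable_compose[OF measurable_fst] pred_sets2[OF _ measurable_ident_sets]) auto
      then have "?g \<in> borel_measurable (borel \<Otimes>\<^sub>M borel)"
        using slice g(1) by (intro measurable_If) (auto intro: predE)
      moreover have "\<forall>x\<in>(\<Union>k\<in>insert k F. U k). \<forall>y\<in>L. \<bar>?g (x, y) - f (x, y)\<bar> \<le> \<epsilon>"
        using g(2) U(3) by auto
      ultimately show ?case by (intro bexI[of _ ?g])
    qed
    then show ?thesis using F(2) by blast
  qed
  have "\<forall>n. \<exists>g \<in> borel_measurable (borel \<Otimes>\<^sub>M borel).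
      \<forall>x\<in>K. \<forall>y\<in>L. \<bar>g (x, y) - f (x, y)\<bar> \<le> inverse (real (Suc n))"
    using approx by simp
  then obtain g where g: "\<And>n. g n \<in> borel_measurable (borel \<Otimes>\<^sub>M borel)"
    "\<And>n x y. x \<in> K \<Longrightarrow> y \<in> L \<Longrightarrow> \<bar>g n (x, y) - f (x, y)\<bar> \<le> inverse (real (Suc n))"
    by metis
  have KL: "K \<times> L \<in> sets (borel \<Otimes>\<^sub>M borel)"
    using K L by (intro pair_measureI borel_closed compact_imp_closed)
  show ?thesis
  proof (rule borel_measurable_LIMSEQ_metric)
    show "(\<lambda>p. g n p * indicator (K \<times> L) p) \<in> borel_measurable (borel \<Otimes>\<^sub>M borel)" for n
      using g(1) KL by (intro borel_measurable_times borel_measurable_indicator)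
    fix p :: "'a \<times> 'b"
    show "(\<lambda>n. g n p * indicator (K \<times> L) p) \<longlonglongrightarrow> f p * indicator (K \<times> L) p"
    proof (cases "p \<in> K \<times> L")
      case True
      then have "\<forall>n. norm (g n p - f p) \<le> inverse (real (Suc n))"
        using g(2)[of "fst p" "snd p"] by auto
      then have "(\<lambda>n. g n p - f p) \<longlonglongrightarrow> 0"
        by (intro Lim_null_comparison[OF _ LIMSEQ_inverse_real_of_nat]) (simp add: always_eventually)
      then show ?thesis using True by (simp add: LIM_zero_iff)
    qed simp
  qed
qed

lemma continuous_pair_borel_measurable:
  fixes f :: "'a::t2_space \<times> 'b::t2_space \<Rightarrow> real" and K :: "nat \<Rightarrow> 'a set" and L :: "nat \<Rightarrow> 'b set"
  assumes f: "continuous_on UNIV f"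
    and K: "\<And>n. compact (K n)" "\<And>x. \<forall>\<^sub>F n in sequentially. x \<in> K n"
    and L: "\<And>n. compact (L n)" "\<And>y. \<forall>\<^sub>F n in sequentially. y \<in> L n"
  shows "f \<in> borel_measurable (borel \<Otimes>\<^sub>M borel)"
proof (rule borel_measurable_LIMSEQ_metric)
  show "(\<lambda>p. f p * indicator (K n \<times> L n) p) \<in> borel_measurable (borel \<Otimes>\<^sub>M borel)" for n
    by (intro continuous_pair_borel_measurable_compact f K L)
  fix p :: "'a \<times> 'b"
  have "\<forall>\<^sub>F n in sequentially. f p * indicator (K n \<times> L n) p = f p"
    using K(2)[of "fst p"] L(2)[of "snd p"] by eventually_elim (auto simp: indicator_def mem_Times_iff)
  then show "(\<lambda>n. f p * indicator (K n \<times> L n) p) \<longlonglongrightarrow> f p"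
    by (rule tendsto_eventually)
qed

section \<open>Proper cocompact isometric actions\<close>

locale proper_cocompact_action =
  fixes d :: "'x::t2_space \<Rightarrow> 'x \<Rightarrow> real"
    and \<mu> :: "'x measure"
    and act :: "'g::{topological_group_add, t2_space} \<Rightarrow> 'x \<Rightarrow> 'x"
  assumes standard: "standard_mm_space d \<mu>"
    and compatible: "compact_sets_bounded d"
    and locally_compact: "locally_compact_space (euclidean :: 'g topology)"
    and action: "continuous_group_action act"
    and mp_isometries: "acts_by_mp_isometries act d \<mu>"
    and proper: "proper_action act"
    and cocompact: "cocompact_action act"
begin

sublocale Metric_space UNIV d
  using standard unfolding standard_mm_space_def metric_measure_space_def by blast

lemma sets_mu: "sets \<mu> = sets borel"
  using standard
  unfolding standard_mm_space_def metric_measure_space_def locally_finite_borel_measure_def by blast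

lemma space_mu: "space \<mu> = UNIV"
  using sets_eq_imp_space_eq[OF sets_mu] by simp

lemma act_0 [simp]: "act 0 x = x"
  using action unfolding continuous_group_action_def by blast

lemma act_add: "act (g + h) x = act g (act h x)"
  using action unfolding continuous_group_action_def by blast

lemma act_minus_act [simp]: "act (- g) (act g x) = x" "act g (act (- g) x) = x"
  by (simp_all flip: act_add)

lemma d_act [simp]: "d (act g x) (act g y) = d x y"
  using mp_isometries unfolding acts_by_mp_isometries_def by blast

lemma d_act_minus: "d x (act (- g + h) y) = d (act g x) (act h y)"
  using d_act[of g x "act (- g + h) y"] by (simp add: act_add)

lemma continuous_act:
  assumes "continuous_on A f" "continuous_on A h"
  shows "continuous_on A (\<lambda>z. act (f z) (h z))"
proof -
  have "continuous_on UNIV (\<lambda>(g, x). act g x)"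
    using action unfolding continuous_group_action_def by blast
  from continuous_on_compose2[OF this continuous_on_Pair[OF assms]] show ?thesis by simp
qed

lemma measurable_act: "act g \<in> measurable \<mu> \<mu>"
  using mp_isometries unfolding acts_by_mp_isometries_def by blast

lemma distr_act: "distr \<mu> \<mu> (act g) = \<mu>"
  using mp_isometries unfolding acts_by_mp_isometries_def by blast

lemma closed_ball_measurable: "mcball x r \<in> sets \<mu>"
proof -
  have "(\<lambda>(x, y). d x y) \<in> borel_measurable (borel :: ('x \<times> 'x) measure)"
    using standard unfolding standard_mm_space_def metric_measure_space_def by blast
  moreover have "(\<lambda>y. (x, y)) \<in> measurable borel (borel :: ('x \<times> 'x) measure)"
    by (intro borel_measurable_continuous_onI continuous_intros)
  ultimately have "(\<lambda>y. (\<lambda>(x, y). d x y) (x, y)) \<in> borel_measurable borel"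
    by (rule measurable_compose[rotated])
  then have "{y \<in> space borel. d x y \<le> r} \<in> sets borel" by (simp add: borel_measurable_iff_le)
  moreover have "mcball x r = {y \<in> space borel. d x y \<le> r}" by auto
  ultimately show ?thesis using sets_mu by simp
qed

lemma compact_closure_ball: "compact (closure (mcball x r))"
  using standard
  unfolding standard_mm_space_def metric_measure_space_def relatively_compact_def by blast

lemma compact_bounded:
  assumes "compact K"
  shows "\<exists>R\<ge>0. \<forall>x\<in>K. d x0 x \<le> R"
proof -
  have "mbounded (insert x0 K)"
    using compatible assms unfolding compact_sets_bounded_def by (simp add: mbounded_insert)
  then obtain B where B: "\<forall>x\<in>insert x0 K. \<forall>y\<in>insert x0 K. d x y \<le> B"
    unfolding mbounded_alt by blast
  show ?thesis
    using B by (intro exI[of _ "max 0 B"]) (auto simp: max_def intro: order_trans)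
qed

lemma orbit_coarsely_dense:
  obtains D where "D \<ge> 0" "\<And>x. \<exists>g. d (act g x0) x \<le> D"
proof -
  obtain K where K: "compact K" "(\<Union>g. act g ` K) = UNIV"
    using cocompact unfolding cocompact_action_def by blast
  obtain D where D: "D \<ge> 0" "\<And>x. x \<in> K \<Longrightarrow> d x0 x \<le> D"
    using compact_bounded[OF K(1)] by blast
  show ?thesis
  proof (rule that[OF D(1)])
    fix x
    obtain g k where "k \<in> K" "x = act g k" using K(2) by blast
    then show "\<exists>g. d (act g x0) x \<le> D" using D(2)[of k] by (intro exI[of _ g]) simp
  qed
qed

text \<open>An element that moves \<open>x0\<close> by at most \<open>r\<close> moves the compact set \<open>C\<close>, consisting of \<open>x0\<close> and the
  closure of the ball, to a set that still meets \<open>C\<close>; properness applies to \<open>C\<close>.\<close>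

lemma compact_orbit_ball: "compact (closure {g. d x0 (act g x0) \<le> r})"
proof -
  define C where "C = insert x0 (closure (mcball x0 r))"
  have C: "compact C" unfolding C_def by (intro compact_insert compact_closure_ball)
  have "act g ` C \<inter> C \<noteq> {}" if "d x0 (act g x0) \<le> r" for g
  proof -
    have "act g x0 \<in> C" using that closure_subset[of "mcball x0 r"] unfolding C_def by auto
    moreover have "x0 \<in> C" unfolding C_def by simp
    ultimately show ?thesis by blast
  qed
  then have "{g. d x0 (act g x0) \<le> r} \<subseteq> {g. act g ` C \<inter> C \<noteq> {}}"
    by (intro Collect_mono) simp
  then have "{g. d x0 (act g x0) \<le> r} \<subseteq> closure {g. act g ` C \<inter> C \<noteq> {}}"
    using closure_subset by (rule subset_trans)
  moreover have "compact (closure {g. act g ` C \<inter> C \<noteq> {}})"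
    using proper C unfolding proper_action_def relatively_compact_def by blast
  ultimately show ?thesis
    using relatively_compact_subset unfolding relatively_compact_def by blast
qed

section \<open>Coarse geometry of the orbit\<close>

lemma chain_partial_length:
  "d (s i) (s (i + k)) \<le> (\<Sum>j = i..<i + k. d (s j) (s (Suc j)))"
proof (induction k)
  case (Suc k)
  then show ?case using triangle[of "s i" "s (i + k)" "s (i + Suc k)"] by simp
qed simp

text \<open>Geodesic chains may have arbitrarily short steps. Stopping at the first point of the chain
  that is further than \<open>1\<close> from its start gives a step of definite length.\<close>

lemma intermediate_point:
  assumes "d x y > 1"
  obtains z where "1 < d x z" "d x z \<le> 2" "d x z + d z y = d x y"
proof -
  obtain n :: nat and s where s: "s 0 = x" "s n = y" "\<And>i. i < n \<Longrightarrow> d (s i) (s (Suc i)) \<le> 1"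
    "d x y = (\<Sum>i<n. d (s i) (s (Suc i)))"
    using standard unfolding standard_mm_space_def by metis
  define i where "i = (LEAST i. 1 < d x (s i))"
  have i: "1 < d x (s i)" unfolding i_def by (rule LeastI[of _ n]) (use assms s in simp)
  have i_le: "i \<le> n" unfolding i_def by (rule Least_le) (use assms s in simp)
  have "i \<noteq> 0" using i s(1) by (intro notI) simp
  then obtain j where j: "i = Suc j" by (cases i) auto
  have "\<not> 1 < d x (s j)"
    using not_less_Least[of j "\<lambda>i. 1 < d x (s i)"] j unfolding i_def by simp
  then have two: "d x (s i) \<le> 2"
    using triangle[of x "s j" "s i"] s(3)[of j] j i_le by simp
  have "d x (s i) \<le> (\<Sum>j = 0..<i. d (s j) (s (Suc j)))"
    using chain_partial_length[of s 0 i] s(1) by simp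
  moreover have "d (s i) y \<le> (\<Sum>j = i..<n. d (s j) (s (Suc j)))"
    using chain_partial_length[of s i "n - i"] s(2) i_le by simp
  moreover have "(\<Sum>j = 0..<i. d (s j) (s (Suc j))) + (\<Sum>j = i..<n. d (s j) (s (Suc j))) = d x y"
    using s(4) sum.atLeastLessThan_concat[of 0 i n "\<lambda>j. d (s j) (s (Suc j))"] i_le
    by (simp add: atLeast0LessThan)
  ultimately have "d x (s i) + d (s i) y = d x y"
    using triangle[of x "s i" y] by simp
  with i two show ?thesis by (rule that)
qed

text \<open>Follow a chain from \<open>x\<close> to \<open>y\<close> with steps of length at most \<open>2\<close>, choose an orbit point within \<open>D\<close> of each of
  its points, and read off the group elements taking each orbit point to the next. They move \<open>x0\<close> by
  at most \<open>D + 2 + D\<close>. Since every step except the last advances by more than \<open>1\<close>, the number of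
  letters is controlled by the distance. This yields both compact generation and the lower
  quasi-isometry bound.\<close>

lemma orbit_word:
  assumes D: "\<And>x. \<exists>g. d (act g x0) x \<le> D"
    and "d (act g x0) x \<le> D" "d (act h x0) y \<le> D" "d x y \<le> real N"
  shows "\<exists>ws. set ws \<subseteq> {q. d x0 (act q x0) \<le> 2 * D + 2} \<and> length ws \<le> Suc N \<and> sum_list ws = - g + h"
  using assms(2-)
proof (induction N arbitrary: g x)
  case (0 g x)
  then have "d (act g x0) (act h x0) \<le> 2 * D + 2"
    using triangle[of "act g x0" x "act h x0"] triangle[of x y "act h x0"] commute[of y "act h x0"]
    by simp
  then show ?case by (intro exI[of _ "[- g + h]"]) (simp add: d_act_minus)
next
  case (Suc N g x)
  show ?case
  proof (cases "d x y \<le> 1")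
    case True
    with Suc.prems have "d (act g x0) (act h x0) \<le> 2 * D + 2"
      using triangle[of "act g x0" x "act h x0"] triangle[of x y "act h x0"] commute[of y "act h x0"]
      by simp
    then show ?thesis by (intro exI[of _ "[- g + h]"]) (simp add: d_act_minus)
  next
    case False
    then obtain z where z: "1 < d x z" "d x z \<le> 2" "d x z + d z y = d x y"
      using intermediate_point[of x y] by auto
    obtain k where k: "d (act k x0) z \<le> D" using D by blast
    have "d z y \<le> real N" using z Suc.prems(3) by simp
    from Suc.IH[OF k Suc.prems(2) this]
    obtain ws where ws: "set ws \<subseteq> {q. d x0 (act q x0) \<le> 2 * D + 2}" "length ws \<le> Suc N"
      "sum_list ws = - k + h" by blast
    have "d (act g x0) (act k x0) \<le> 2 * D + 2"
      using triangle[of "act g x0" x "act k x0"] triangle[of x z "act k x0"] commute[of z "act k x0"]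
        Suc.prems(1) z k by simp
    with ws show ?thesis
      by (intro exI[of _ "(- g + k) # ws"]) (simp add: d_act_minus add.assoc)
  qed
qed

proposition compactly_generated: "\<exists>S :: 'g set. compact S \<and> generates S"
proof -
  obtain x0 :: 'x where True by blast
  obtain D where D: "D \<ge> 0" "\<And>x. \<exists>g. d (act g x0) x \<le> D"
    using orbit_coarsely_dense[of x0] by blast
  define Q where "Q = {q. d x0 (act q x0) \<le> 2 * D + 2}"
  have "\<exists>ws. set ws \<subseteq> closure Q \<union> uminus ` closure Q \<and> sum_list ws = g" for g
  proof -
    have "d x0 (act g x0) \<le> real (nat \<lceil>d x0 (act g x0)\<rceil>)" by (rule real_nat_ceiling_ge)
    with orbit_word[OF D(2), of 0 x0 g "act g x0" "nat \<lceil>d x0 (act g x0)\<rceil>"] D(1)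
    obtain ws where "set ws \<subseteq> Q" "sum_list ws = - 0 + g" unfolding Q_def by auto
    then show ?thesis using closure_subset[of Q] by (intro exI[of _ ws]) auto
  qed
  then have "generates (closure Q)" unfolding generates_def by blast
  moreover have "compact (closure Q)" unfolding Q_def by (rule compact_orbit_ball)
  ultimately show ?thesis by blast
qed

text \<open>The letters supplied by \<open>orbit_word\<close> form a relatively compact set, on which the word length
  with respect to any compact generating set is bounded.\<close>

lemma word_length_le_orbit_distance:
  assumes S: "compact S" "generates S"
  obtains T where "T \<ge> 0" "\<And>g h. word_metric S g h \<le> T * (d (act g x0) (act h x0) + 2)"
proof -
  obtain D where D: "D \<ge> 0" "\<And>x. \<exists>g. d (act g x0) x \<le> D"
    using orbit_coarsely_dense[of x0] by blast
  define Q where "Q = {q. d x0 (act q x0) \<le> 2 * D + 2}"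
  have "compact (closure Q)" unfolding Q_def by (rule compact_orbit_ball)
  then obtain T where T: "\<And>q. q \<in> closure Q \<Longrightarrow> word_length S q \<le> T"
    using word_length_bounded_on_compact[OF locally_compact S] by blast
  have words: "word_length S (sum_list ws) \<le> T * length ws" if "set ws \<subseteq> Q" for ws
    using that
  proof (induction ws)
    case Nil
    then show ?case using word_length_eq_0_iff[OF S(2), of 0] by simp
  next
    case (Cons w ws)
    then have "w \<in> closure Q" using closure_subset[of Q] by auto
    then show ?case
      using Cons T[of w] word_length_add_le[OF S(2), of w "sum_list ws"] by simp
  qed
  show ?thesis
  proof (rule that[of "real T"])
    fix g h
    let ?N = "nat \<lceil>d (act g x0) (act h x0)\<rceil>"
    have "d (act g x0) (act h x0) \<le> real ?N" by (rule real_nat_ceiling_ge)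
    with orbit_word[OF D(2), of g "act g x0" h "act h x0" ?N] D(1)
    obtain ws where ws: "set ws \<subseteq> Q" "length ws \<le> Suc ?N" "sum_list ws = - g + h"
      unfolding Q_def by auto
    have "word_length S (- g + h) \<le> T * length ws" using words[OF ws(1)] ws(3) by simp
    also have "\<dots> \<le> T * Suc ?N" using ws(2) by (rule mult_le_mono2)
    finally have le: "word_metric S g h \<le> real (T * Suc ?N)"
      unfolding word_metric_def by (rule of_nat_mono)
    have "real ?N = real_of_int \<lceil>d (act g x0) (act h x0)\<rceil>" by simp
    then have "real (Suc ?N) \<le> d (act g x0) (act h x0) + 2"
      using of_int_ceiling_le_add_one[of "d (act g x0) (act h x0)"] by linarith
    then have "real T * real (Suc ?N) \<le> real T * (d (act g x0) (act h x0) + 2)"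
      by (rule mult_left_mono) simp
    with le show "word_metric S g h \<le> real T * (d (act g x0) (act h x0) + 2)"
      unfolding of_nat_mult by (rule order_trans)
  qed simp
qed

lemma orbit_distance_le_word_length:
  assumes S: "compact S" "generates S"
  obtains M where "M \<ge> 0" "\<And>g h. d (act g x0) (act h x0) \<le> M * word_metric S g h"
proof -
  have "compact ((\<lambda>s. act s x0) ` S)"
    by (intro compact_continuous_image S continuous_act continuous_intros)
  from compact_bounded[OF this, of x0]
  obtain M where M: "M \<ge> 0" "\<And>s. s \<in> S \<Longrightarrow> d x0 (act s x0) \<le> M" by auto
  have letter: "d x0 (act w x0) \<le> M" if "w \<in> S \<union> uminus ` S" for w
    using that
  proof
    assume "w \<in> uminus ` S"
    then obtain s where "s \<in> S" "w = - s" by blast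
    then show ?thesis using M(2)[of s] d_act_minus[of x0 s 0 x0] commute by simp
  qed (use M in blast)
  have words: "d x0 (act (sum_list ws) x0) \<le> M * length ws" if "set ws \<subseteq> S \<union> uminus ` S" for ws
    using that
  proof (induction ws)
    case (Cons w ws)
    have "w \<in> S \<union> uminus ` S" "set ws \<subseteq> S \<union> uminus ` S" using Cons.prems by simp_all
    then show ?case
      using letter[of w] Cons.IH triangle[of x0 "act w x0" "act w (act (sum_list ws) x0)"]
      by (simp add: act_add algebra_simps)
  qed simp
  show ?thesis
  proof (rule that[OF M(1)])
    fix g h
    obtain ws where ws: "length ws = word_length S (- g + h)" "set ws \<subseteq> S \<union> uminus ` S"
      "sum_list ws = - g + h"
      using word_length_obtain[OF S(2)] .
    show "d (act g x0) (act h x0) \<le> M * word_metric S g h"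
      using words[OF ws(2)] ws(1) unfolding ws(3) word_metric_def d_act_minus by simp
  qed
qed

proposition quasi_isometry_orbit_map:
  assumes S: "compact S" "generates S"
  shows "quasi_isometry (word_metric S) d (\<lambda>g. act g x0)"
proof -
  obtain D where D: "D \<ge> 0" "\<And>x. \<exists>g. d (act g x0) x \<le> D"
    using orbit_coarsely_dense[of x0] by blast
  obtain T where T: "T \<ge> 0" "\<And>g h. word_metric S g h \<le> T * (d (act g x0) (act h x0) + 2)"
    using word_length_le_orbit_distance[OF S] by blast
  obtain M where M: "M \<ge> 0" "\<And>g h. d (act g x0) (act h x0) \<le> M * word_metric S g h"
    using orbit_distance_le_word_length[OF S] by blast
  define C where "C = 1 + T + M"
  have C: "C \<ge> 1" "T \<le> C" "M \<le> C" using T(1) M(1) by (auto simp: C_def)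
  have "1 / C * word_metric S g h - (2 + D) \<le> d (act g x0) (act h x0)" for g h
  proof -
    have "T * (d (act g x0) (act h x0) + 2) \<le> C * (d (act g x0) (act h x0) + 2)"
      using C(2) by (intro mult_right_mono) auto
    with T(2)[of g h] have "word_metric S g h \<le> C * (d (act g x0) (act h x0) + 2)"
      by (rule order_trans)
    then have "word_metric S g h / C \<le> d (act g x0) (act h x0) + 2"
      using C(1) by (simp add: divide_le_eq mult.commute)
    then show ?thesis using D(1) by simp
  qed
  moreover have "d (act g x0) (act h x0) \<le> C * word_metric S g h + (2 + D)" for g h
  proof -
    have "M * word_metric S g h \<le> C * word_metric S g h"
      using C(3) by (intro mult_right_mono) (auto simp: word_metric_def)
    then show ?thesis using M(2)[of g h] D(1) by linarith
  qed
  moreover have "\<exists>g. d x (act g x0) \<le> 2 + D" for x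
  proof -
    obtain g where "d (act g x0) x \<le> D" using D(2) by blast
    then show ?thesis using commute[of x "act g x0"] by (intro exI[of _ g]) simp
  qed
  ultimately show ?thesis
    unfolding quasi_isometry_def using C(1) D(1)
    by (intro exI[of _ C] exI[of _ "2 + D"]) auto
qed


section \<open>Boundaries and separated sets\<close>

text \<open>A geodesic chain from \<open>a\<close> to \<open>b\<close> must leave \<open>A\<close>. It does so in a step of length at most \<open>1\<close>, so the
  whole unit ball around the last point before leaving \<open>A\<close> lies in the \<open>2\<close>-boundary. That point is
  within \<open>d a b \<le> 2 * r\<close> of \<open>a\<close>, which gives the radius \<open>3 * r\<close>.\<close>

lemma crossing_point:
  assumes "a \<in> A" "b \<notin> A" "d x a \<le> r" "d x b \<le> r"
  obtains y where "mcball y 1 \<subseteq> boundary d 2 A" "d x y \<le> 3 * r"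
proof -
  obtain n :: nat and s where s: "s 0 = a" "s n = b" "\<And>i. i < n \<Longrightarrow> d (s i) (s (Suc i)) \<le> 1"
    "d a b = (\<Sum>i<n. d (s i) (s (Suc i)))"
    using standard unfolding standard_mm_space_def by metis
  define i where "i = (LEAST i. s i \<notin> A)"
  have i: "s i \<notin> A" unfolding i_def by (rule LeastI[of _ n]) (use assms s in simp)
  have i_le: "i \<le> n" unfolding i_def by (rule Least_le) (use assms s in simp)
  have "i \<noteq> 0" using i s(1) assms(1) by (intro notI) simp
  then obtain j where j: "i = Suc j" by (cases i) auto
  have sj: "s j \<in> A" using not_less_Least[of j "\<lambda>i. s i \<notin> A"] j unfolding i_def by simp
  have step: "d (s j) (s i) \<le> 1" using s(3)[of j] j i_le by simp
  have "d a (s j) \<le> (\<Sum>k = 0..<j. d (s k) (s (Suc k)))"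
    using chain_partial_length[of s 0 j] s(1) by simp
  also have "\<dots> \<le> (\<Sum>k<n. d (s k) (s (Suc k)))"
    using j i_le by (intro sum_mono2) auto
  finally have "d a (s j) \<le> d a b" using s(4) by simp
  then have near: "d x (s j) \<le> 3 * r"
    using triangle[of x a "s j"] triangle[of a x b] commute[of a x] assms(3,4) by simp
  have in_thickening: "p \<in> thickening d 2 B" if "c \<in> B" "d p c \<le> 2" for p c B
  proof -
    have "(INF c\<in>B. d p c) \<le> d p c"
      using that(1) by (intro cINF_lower bdd_belowI2[of _ 0]) auto
    then show ?thesis using that unfolding thickening_def by auto
  qed
  have "mcball (s j) 1 \<subseteq> boundary d 2 A"
  proof
    fix p assume "p \<in> mcball (s j) 1"
    then have "d p (s j) \<le> 2" "d p (s i) \<le> 2"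
      using triangle[of p "s j" "s i"] step commute[of p "s j"] by auto
    then show "p \<in> boundary d 2 A"
      unfolding boundary_def using in_thickening[of "s j" A p] in_thickening[of "s i" "- A" p] sj i
      by simp
  qed
  with near show ?thesis by (rule that[rotated])
qed

text \<open>Take a largest set of points at mutual distances greater than \<open>2\<close> whose unit balls lie in \<open>B\<close>. These
  balls are disjoint, so their total measure, hence their number, is controlled by the outer measure
  of \<open>B\<close>, and by maximality every other such point is within \<open>2\<close> of the set.\<close>

lemma separated_net:
  assumes v: "v > 0" "\<And>x. ennreal v \<le> emeasure \<mu> (mcball x 1)"
    and B: "outer_measure_of \<mu> B < \<infinity>"
  obtains N where "finite N" "of_nat (card N) * ennreal v \<le> outer_measure_of \<mu> B"
    "\<And>y. mcball y 1 \<subseteq> B \<Longrightarrow> \<exists>n\<in>N. d y n \<le> 2"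
proof -
  define P where "P N \<longleftrightarrow> finite N \<and> (\<forall>n\<in>N. mcball n 1 \<subseteq> B) \<and>
    (\<forall>m\<in>N. \<forall>n\<in>N. m \<noteq> n \<longrightarrow> d m n > 2)" for N
  have bound: "of_nat (card N) * ennreal v \<le> outer_measure_of \<mu> B" if "P N" for N
  proof -
    have N: "finite N" "\<And>n. n \<in> N \<Longrightarrow> mcball n 1 \<subseteq> B"
      "\<And>m n. m \<in> N \<Longrightarrow> n \<in> N \<Longrightarrow> m \<noteq> n \<Longrightarrow> d m n > 2"
      using that unfolding P_def by blast+
    have disj: "disjoint_family_on (\<lambda>n. mcball n 1) N"
      unfolding disjoint_family_on_def
    proof (intro ballI impI)
      fix m n assume mn: "m \<in> N" "n \<in> N" "m \<noteq> n"
      have False if "p \<in> mcball m 1" "p \<in> mcball n 1" for p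
        using that N(3)[OF mn] triangle[of m p n] commute[of p n] by simp
      then show "mcball m 1 \<inter> mcball n 1 = {}" by blast
    qed
    have "of_nat (card N) * ennreal v = (\<Sum>n\<in>N. ennreal v)" by simp
    also have "\<dots> \<le> (\<Sum>n\<in>N. emeasure \<mu> (mcball n 1))" using v(2) by (intro sum_mono)
    also have "\<dots> = emeasure \<mu> (\<Union>n\<in>N. mcball n 1)"
      using N(1) disj closed_ball_measurable by (intro sum_emeasure) auto
    also have "\<dots> = outer_measure_of \<mu> (\<Union>n\<in>N. mcball n 1)"
      using N(1) closed_ball_measurable by (intro outer_measure_of_eq[symmetric]) auto
    also have "\<dots> \<le> outer_measure_of \<mu> B"
      using N(2) by (intro outer_measure_of_mono) blast
    finally show ?thesis .
  qed
  obtain b where b: "outer_measure_of \<mu> B = ennreal b" "b \<ge> 0"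
    using B by (cases "outer_measure_of \<mu> B") auto
  have "card N \<le> nat \<lceil>b / v\<rceil>" if "P N" for N
  proof -
    have "ennreal (real (card N) * v) \<le> ennreal b"
      using bound[OF that] b v(1) by (simp add: ennreal_mult ennreal_of_nat_eq_real_of_nat)
    then have "real (card N) \<le> b / v"
      using b(2) v(1) by (simp add: pos_le_divide_eq)
    then show ?thesis by linarith
  qed
  moreover have "P {}" unfolding P_def by simp
  ultimately obtain N where N: "P N" "\<And>N'. P N' \<Longrightarrow> card N' \<le> card N"
    using ex_has_greatest_nat[of P "{}" card "Suc (nat \<lceil>b / v\<rceil>)"] by (auto simp: less_Suc_eq_le)
  show ?thesis
  proof (rule that)
    show "finite N" using N(1) unfolding P_def by blast
    show "of_nat (card N) * ennreal v \<le> outer_measure_of \<mu> B" by (rule bound[OF N(1)])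
    fix y assume y: "mcball y 1 \<subseteq> B"
    show "\<exists>n\<in>N. d y n \<le> 2"
    proof (rule ccontr)
      assume "\<not> (\<exists>n\<in>N. d y n \<le> 2)"
      then have far: "\<And>n. n \<in> N \<Longrightarrow> d y n > 2 \<and> d n y > 2" using commute by (metis not_le)
      then have "y \<notin> N" by fastforce
      moreover have "P (insert y N)" using N(1) y far unfolding P_def by auto
      ultimately show False
        using N(2)[of "insert y N"] \<open>finite N\<close> by simp
    qed
  qed
qed

section \<open>Bump functions\<close>

text \<open>Local compactness gives, near each point, a continuous function supported in a compact set. A
  finite sum of such functions is positive on a compact set whose translates cover the space.
  Its support is bounded because compact sets are.\<close>

lemma exists_bump:
  "\<exists>(\<phi> :: 'x \<Rightarrow> real) B R. continuous_on UNIV \<phi> \<and> (\<forall>x. 0 \<le> \<phi> x) \<and> (\<forall>x. \<phi> x \<le> B) \<and>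
     (\<forall>x. \<phi> x \<noteq> 0 \<longrightarrow> d x0 x \<le> R) \<and> (\<forall>x. \<exists>g. \<phi> (act g x) > 0)"
proof -
  obtain K where K: "compact K" "(\<Union>g. act g ` K) = UNIV"
    using cocompact unfolding cocompact_action_def by blast
  have lc: "locally_compact_space (euclidean :: 'x topology)"
    using standard unfolding standard_mm_space_def metric_measure_space_def by blast
  have cr: "completely_regular_space (euclidean :: 'x topology)"
    by (intro locally_compact_regular_imp_completely_regular_space lc disjI1 Hausdorff_space_t2)
  have "\<exists>f::'x \<Rightarrow> real. continuous_on UNIV f \<and> (\<forall>x. 0 \<le> f x \<and> f x \<le> 1) \<and> f k = 1 \<and>
      (\<exists>R. \<forall>x. f x \<noteq> 0 \<longrightarrow> d x0 x \<le> R)" for k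
  proof -
    obtain U C where U: "open U" "compact C" "k \<in> U" "U \<subseteq> C"
      using locally_compact_nbhdE[OF lc] .
    then have "closedin euclidean (- U)" "k \<in> topspace euclidean - (- U)" by auto
    then obtain f :: "'x \<Rightarrow> real" where f: "continuous_map euclidean (top_of_set {0..1}) f"
      "f k = 0" "f ` (- U) \<subseteq> {1}"
      using cr unfolding completely_regular_space_def by blast
    have f1: "continuous_on UNIV f" "\<And>x. 0 \<le> f x \<and> f x \<le> 1"
      using f(1) by (auto simp: continuous_map_in_subtopology)
    obtain R where R: "\<forall>x\<in>C. d x0 x \<le> R" using compact_bounded[OF U(2)] by blast
    have "d x0 x \<le> R" if "1 - f x \<noteq> 0" for x
    proof -
      have "x \<in> U" using that f(3) by auto
      then show ?thesis using R U(4) by blast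
    qed
    then show ?thesis
      using f1 f(2) by (intro exI[of _ "\<lambda>x. 1 - f x"]) (auto intro!: continuous_intros)
  qed
  then obtain f :: "'x \<Rightarrow> 'x \<Rightarrow> real" where f: "\<And>k. continuous_on UNIV (f k)"
    "\<And>k x. 0 \<le> f k x \<and> f k x \<le> 1" "\<And>k. f k k = 1" "\<And>k. \<exists>R. \<forall>x. f k x \<noteq> 0 \<longrightarrow> d x0 x \<le> R"
    by metis
  from f(4) obtain R where R: "\<And>k x. f k x \<noteq> 0 \<Longrightarrow> d x0 x \<le> R k" by metis
  have opn: "open (f k -` {0<..})" for k
    using f(1) by (intro open_vimage) auto
  have "k \<in> f k -` {0<..}" for k using f(3)[of k] by simp
  then have sub: "K \<subseteq> (\<Union>k\<in>K. f k -` {0<..})" by blast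
  obtain F where "F \<subseteq> K" and F: "finite F" "K \<subseteq> (\<Union>k\<in>F. f k -` {0<..})"
    by (rule compactE_image[OF K(1) opn sub])
  let ?\<phi> = "\<lambda>x. \<Sum>k\<in>F. f k x"
  show ?thesis
  proof (rule exI[of _ ?\<phi>], rule exI[of _ "real (card F)"], rule exI[of _ "Max (R ` F)"],
      intro conjI allI impI)
    show "continuous_on UNIV ?\<phi>" by (intro continuous_on_sum f)
    show "0 \<le> ?\<phi> x" for x using f(2) by (intro sum_nonneg) blast
    show "?\<phi> x \<le> real (card F)" for x
      using sum_bounded_above[of F "\<lambda>k. f k x" 1] f(2) by simp
    show "d x0 x \<le> Max (R ` F)" if nonzero: "?\<phi> x \<noteq> 0" for x
    proof -
      obtain k where k: "k \<in> F" "f k x \<noteq> 0" 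
        using sum.not_neutral_contains_not_neutral[OF nonzero] by blast
      then have "R k \<le> Max (R ` F)" using F(1) by (intro Max_ge) auto
      then show ?thesis using R[OF k(2)] by simp
    qed
    show "\<exists>g. ?\<phi> (act g x) > 0" for x
    proof -
      obtain g y where gy: "y \<in> K" "x = act g y" using K(2) by blast
      then obtain k where "k \<in> F" "f k y > 0" using F(2) by auto
      then have "?\<phi> y > 0" using F(1) f(2) by (intro sum_pos2) auto
      then show ?thesis using gy(2) by (intro exI[of _ "- g"]) simp
    qed
  qed
qed

end

section \<open>Averaging over the group\<close>

locale proper_cocompact_action_haar = proper_cocompact_action d \<mu> act
  for d :: "'x::t2_space \<Rightarrow> 'x \<Rightarrow> real"
    and \<mu> :: "'x measure"
    and act :: "'g::{topological_group_add, t2_space} \<Rightarrow> 'x \<Rightarrow> 'x" +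
  fixes l :: "'g measure" and x0 :: 'x
  assumes haar: "left_haar_measure l"
begin

lemma sets_l: "sets l = sets borel"
  by (rule left_haar_measureD[OF haar])

lemma space_l: "space l = UNIV"
  using sets_eq_imp_space_eq[OF sets_l] by simp

lemma l_translate: "A \<in> sets l \<Longrightarrow> emeasure l ((+) g ` A) = emeasure l A"
  by (rule left_haar_measureD[OF haar])

lemma measurable_orbit_map: "(\<lambda>g. act g x) \<in> measurable l \<mu>"
proof -
  have "(\<lambda>g. act g x) \<in> measurable borel borel"
    by (intro borel_measurable_continuous_onI continuous_act continuous_intros)
  then show ?thesis using measurable_cong_sets[OF sets_l sets_mu] by blast
qed

definition orbit_ball :: "real \<Rightarrow> 'g set" where
  "orbit_ball r = {g. d x0 (act g x0) \<le> r}"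

lemma orbit_ball_measurable: "orbit_ball r \<in> sets l"
proof -
  have "orbit_ball r = (\<lambda>g. act g x0) -` mcball x0 r \<inter> space l"
    by (auto simp: orbit_ball_def space_l)
  then show ?thesis
    using measurable_sets[OF measurable_orbit_map closed_ball_measurable] by simp
qed

lemma orbit_ball_finite: "emeasure l (orbit_ball r) < \<infinity>"
proof -
  have c: "compact (closure (orbit_ball r))" unfolding orbit_ball_def by (rule compact_orbit_ball)
  have "emeasure l (orbit_ball r) \<le> emeasure l (closure (orbit_ball r))"
    by (intro emeasure_mono closure_subset) (simp add: sets_l)
  also have "\<dots> < \<infinity>" by (rule left_haar_measureD(4)[OF haar c])
  finally show ?thesis .
qed

lemma orbit_ball_pos: "\<exists>r. 0 < emeasure l (orbit_ball r)"
proof -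
  obtain U C where U: "open U" "compact C" "(0::'g) \<in> U" "U \<subseteq> C"
    using locally_compact_nbhdE[OF locally_compact] .
  have "compact ((\<lambda>g. act g x0) ` C)"
    by (intro compact_continuous_image U continuous_act continuous_intros)
  then obtain r where "\<forall>z\<in>(\<lambda>g. act g x0) ` C. d x0 z \<le> r" using compact_bounded by blast
  then have "U \<subseteq> orbit_ball r" using U(4) unfolding orbit_ball_def by auto
  then have "emeasure l U \<le> emeasure l (orbit_ball r)"
    using orbit_ball_measurable by (intro emeasure_mono)
  moreover have "0 < emeasure l U" using U(1,3) by (intro left_haar_measure_open_pos[OF haar]) auto
  ultimately show ?thesis by (intro exI[of _ r]) (rule order_less_le_trans)
qed

lemma sigma_finite_l: "sigma_finite_measure l"
proof
  have "\<exists>n::nat. g \<in> orbit_ball (real n)" for g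
    unfolding orbit_ball_def by (simp add: real_arch_simple)
  then have "\<Union>(range (\<lambda>n::nat. orbit_ball (real n))) = space l"
    unfolding space_l by blast
  then show "\<exists>A. countable A \<and> A \<subseteq> sets l \<and> \<Union>A = space l \<and> (\<forall>a\<in>A. emeasure l a \<noteq> \<infinity>)"
    using orbit_ball_measurable orbit_ball_finite
    by (intro exI[of _ "range (\<lambda>n::nat. orbit_ball (real n))"]) (auto simp: less_top[symmetric])
qed

lemma ball_measure_finite: "emeasure \<mu> (mcball x r) < \<infinity>"
proof -
  have "1 \<le> max 1 r" by simp
  then obtain V where V: "emeasure \<mu> (mcball x (max 1 r)) \<le> ennreal V"
    using standard unfolding standard_mm_space_def by blast
  have "emeasure \<mu> (mcball x r) \<le> emeasure \<mu> (mcball x (max 1 r))"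
    using closed_ball_measurable by (intro emeasure_mono mcball_subset_concentric) auto
  also have "\<dots> < \<infinity>" using V by (simp add: order_le_less_trans)
  finally show ?thesis .
qed

lemma sigma_finite_mu: "sigma_finite_measure \<mu>"
proof
  let ?A = "range (\<lambda>n::nat. mcball x0 (real (Suc n)))"
  have "\<exists>n::nat. x \<in> mcball x0 (real (Suc n))" for x
  proof -
    obtain n :: nat where "d x0 x \<le> real n" using real_arch_simple by blast
    then show ?thesis by (intro exI[of _ n]) simp
  qed
  then have "\<Union>?A = space \<mu>" unfolding space_mu by blast
  moreover have "emeasure \<mu> (mcball x0 (real (Suc n))) \<noteq> \<infinity>" for n
    using ball_measure_finite[of x0 "real (Suc n)"] by simp
  ultimately show "\<exists>A. countable A \<and> A \<subseteq> sets \<mu> \<and> \<Union>A = space \<mu> \<and> (\<forall>a\<in>A. emeasure \<mu> a \<noteq> \<infinity>)"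
    using closed_ball_measurable by (intro exI[of _ ?A]) auto
qed

sublocale pair_sigma_finite l \<mu>
  unfolding pair_sigma_finite_def using sigma_finite_l sigma_finite_mu by blast

lemma sets_pair: "sets (l \<Otimes>\<^sub>M \<mu>) = sets (borel \<Otimes>\<^sub>M borel)"
  by (intro sets_pair_measure_cong sets_l sets_mu)

lemma nn_integral_act:
  assumes "f \<in> borel_measurable \<mu>"
  shows "(\<integral>\<^sup>+x. f (act g x) \<partial>\<mu>) = integral\<^sup>N \<mu> f"
  using nn_integral_distr[OF measurable_act, of f g] assms unfolding distr_act by simp

lemma nn_integral_translate:
  assumes "f \<in> borel_measurable l"
  shows "(\<integral>\<^sup>+h. f (g + h) \<partial>l) = integral\<^sup>N l f"
proof -
  have "(+) g \<in> measurable borel borel"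
    by (intro borel_measurable_continuous_onI continuous_intros)
  then have "(+) g \<in> measurable l l" using measurable_cong_sets[OF sets_l sets_l] by blast
  from nn_integral_distr[OF this, of f] show ?thesis
    using assms unfolding left_haar_measure_distr[OF haar] by simp
qed

text \<open>Continuity of the bump function \<open>\<phi>\<close> makes \<open>(g, x) \<mapsto> \<phi> (- g \<cdot> x)\<close> measurable for the product
  sigma-algebra, so that Fubini's theorem applies. Its integral \<open>F x\<close> over \<open>g\<close> is an invariant function of
  \<open>x\<close>, positive because \<open>\<phi>\<close> is positive somewhere on each orbit, and finite by properness.
  The function \<open>H = \<phi> / F\<close> thus satisfies \<open>\<integral> H (- g \<cdot> x) dg = 1\<close> for all \<open>x\<close>; integrating this over \<open>A\<close>,
  exchanging the integrals and substituting \<open>g \<cdot> x\<close> for \<open>x\<close> gives the last identity.\<close>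

lemma exists_averaging_function:
  "\<exists>(H :: 'x \<Rightarrow> ennreal) R. H \<in> borel_measurable \<mu> \<and> R \<ge> 0 \<and> (\<forall>x. H x \<noteq> 0 \<longrightarrow> d x0 x \<le> R) \<and>
     (\<forall>A\<in>sets \<mu>. (\<lambda>g. \<integral>\<^sup>+x. indicator A (act g x) * H x \<partial>\<mu>) \<in> borel_measurable l \<and>
       emeasure \<mu> A = (\<integral>\<^sup>+g. (\<integral>\<^sup>+x. indicator A (act g x) * H x \<partial>\<mu>) \<partial>l))"
proof -
  obtain \<phi> :: "'x \<Rightarrow> real" and B R where \<phi>: "continuous_on UNIV \<phi>"
    "\<And>x. 0 \<le> \<phi> x" "\<And>x. \<phi> x \<le> B" "\<And>x. \<phi> x \<noteq> 0 \<Longrightarrow> d x0 x \<le> R" "\<And>x. \<exists>g. \<phi> (act g x) > 0"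
    using exists_bump[of x0] by metis
  have cont: "continuous_on UNIV (\<lambda>(g, x). \<phi> (act (- g) x))"
    unfolding case_prod_unfold
    by (rule continuous_on_compose2[OF \<phi>(1)]) (intro continuous_act continuous_intros, simp)
  have "(\<lambda>(g, x). \<phi> (act (- g) x)) \<in> borel_measurable (borel \<Otimes>\<^sub>M borel)"
  proof (rule continuous_pair_borel_measurable[OF cont])
    show "compact (closure (orbit_ball (real n)))" for n
      unfolding orbit_ball_def by (rule compact_orbit_ball)
    show "compact (closure (mcball x0 (real n)))" for n by (rule compact_closure_ball)
    show "\<forall>\<^sub>F n in sequentially. g \<in> closure (orbit_ball (real n))" for g
      using eventually_ge_at_top[of "nat \<lceil>d x0 (act g x0)\<rceil>"]
    proof eventually_elim
      case (elim n)
      then have "g \<in> orbit_ball (real n)" unfolding orbit_ball_def by (simp add: nat_ceiling_le_eq)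
      then show ?case using closure_subset by blast
    qed
    show "\<forall>\<^sub>F n in sequentially. x \<in> closure (mcball x0 (real n))" for x
      using eventually_ge_at_top[of "nat \<lceil>d x0 x\<rceil>"]
    proof eventually_elim
      case (elim n)
      then have "x \<in> mcball x0 (real n)" by (simp add: nat_ceiling_le_eq)
      then show ?case using closure_subset by blast
    qed
  qed
  then have meas0: "(\<lambda>(g, x). \<phi> (act (- g) x)) \<in> borel_measurable (l \<Otimes>\<^sub>M \<mu>)"
    using measurable_cong_sets[OF sets_pair refl] by blast
  define f where "f g x = ennreal (\<phi> (act (- g) x))" for g x
  have meas: "(\<lambda>(g, x). f g x) \<in> borel_measurable (l \<Otimes>\<^sub>M \<mu>)"
    using measurable_compose[OF meas0 measurable_ennreal] by (simp add: f_def case_prod_unfold)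
  have slice: "(\<lambda>g. f g x) \<in> borel_measurable l" for x
    using measurable_compose[OF measurable_Pair2'[of x \<mu> l] meas] by (simp add: space_mu)
  define F where "F x = (\<integral>\<^sup>+g. f g x \<partial>l)" for x
  have F_meas: "F \<in> borel_measurable \<mu>"
    using M1.borel_measurable_nn_integral[of "\<lambda>x g. f g x" \<mu>] measurable_pair_swap[OF meas]
    unfolding F_def by (simp add: case_prod_unfold)
  have F_inv: "F (act k x) = F x" for k x
  proof -
    have "act (- (k + h)) (act k x) = act (- h) x" for h
      by (simp only: minus_add act_add act_minus_act)
    then show ?thesis
      using nn_integral_translate[OF slice[of "act k x"], of k, symmetric]
      unfolding F_def f_def by simp
  qed
  have F_pos: "F x \<noteq> 0" for x
  proof -
    have "continuous_on UNIV (\<lambda>g. \<phi> (act (- g) x))"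
      by (rule continuous_on_compose2[OF \<phi>(1)]) (intro continuous_act continuous_intros, simp)
    then have opn: "open ((\<lambda>g. \<phi> (act (- g) x)) -` {0<..})" by (intro open_vimage) auto
    obtain g where "\<phi> (act g x) > 0" using \<phi>(5) by blast
    then have "- g \<in> (\<lambda>g. \<phi> (act (- g) x)) -` {0<..}" by simp
    then have "0 < emeasure l ((\<lambda>g. \<phi> (act (- g) x)) -` {0<..})"
      by (intro left_haar_measure_open_pos[OF haar opn]) blast
    moreover have "(\<lambda>g. \<phi> (act (- g) x)) -` {0<..} = {g \<in> space l. f g x \<noteq> 0}"
      by (auto simp: f_def space_l ennreal_eq_0_iff not_le)
    ultimately show ?thesis
      unfolding F_def using nn_integral_0_iff[OF slice[of x]] by simp
  qed
  have F_fin: "F x \<noteq> \<infinity>" for x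
  proof -
    have "f g x \<le> ennreal B * indicator (orbit_ball (R + d x0 x)) g" for g
    proof (cases "g \<in> orbit_ball (R + d x0 x)")
      case True
      then show ?thesis unfolding f_def using \<phi>(3) by (simp add: ennreal_leI)
    next
      case False
      then have "\<not> d x0 (act (- g) x) \<le> R"
        unfolding orbit_ball_def
        using d_act_minus[of x0 g 0 x] triangle[of x0 x "act g x0"] commute[of x "act g x0"] by simp
      then have "\<phi> (act (- g) x) = 0" using \<phi>(4) by blast
      then show ?thesis unfolding f_def by simp
    qed
    then have "F x \<le> (\<integral>\<^sup>+g. ennreal B * indicator (orbit_ball (R + d x0 x)) g \<partial>l)"
      unfolding F_def by (intro nn_integral_mono)
    also have "\<dots> = ennreal B * emeasure l (orbit_ball (R + d x0 x))"
      by (intro nn_integral_cmult_indicator orbit_ball_measurable)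
    also have "\<dots> < \<infinity>"
      using orbit_ball_finite by (simp add: ennreal_mult_less_top)
    finally show ?thesis by simp
  qed
  define H where "H x = ennreal (\<phi> x) / F x" for x
  have \<phi>_meas: "\<phi> \<in> borel_measurable \<mu>"
    using borel_measurable_continuous_onI[OF \<phi>(1)] measurable_cong_sets[OF sets_mu refl] by blast
  have H_meas: "H \<in> borel_measurable \<mu>"
    unfolding H_def using \<phi>_meas F_meas by measurable
  have H_translate: "H (act (- g) x) = f g x / F x" for g x
    unfolding H_def f_def F_inv ..
  have pair_meas: "(\<lambda>(g, x). indicator A x * (f g x / F x)) \<in> borel_measurable (l \<Otimes>\<^sub>M \<mu>)"
    if A: "A \<in> sets \<mu>" for A
    using meas F_meas A by measurable
  have swap: "(\<integral>\<^sup>+x. indicator A (act g x) * H x \<partial>\<mu>) = (\<integral>\<^sup>+x. indicator A x * (f g x / F x) \<partial>\<mu>)"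
    if A: "A \<in> sets \<mu>" for A g
  proof -
    have "(\<lambda>x. H (act (- g) x)) \<in> borel_measurable \<mu>"
      by (rule measurable_compose[OF measurable_act H_meas])
    then have "(\<lambda>x. indicator A x * H (act (- g) x)) \<in> borel_measurable \<mu>" using A by measurable
    from nn_integral_act[OF this, of g] show ?thesis unfolding H_translate[symmetric] by simp
  qed
  show ?thesis
  proof (intro exI[of _ H] exI[of _ "max 0 R"] conjI ballI allI impI)
    show "H \<in> borel_measurable \<mu>" by (rule H_meas)
    show "d x0 x \<le> max 0 R" if "H x \<noteq> 0" for x
      using that \<phi>(4)[of x] unfolding H_def by (cases "\<phi> x = 0") auto
    fix A assume A: "A \<in> sets \<mu>"
    show "(\<lambda>g. \<integral>\<^sup>+x. indicator A (act g x) * H x \<partial>\<mu>) \<in> borel_measurable l"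
      unfolding swap[OF A] using pair_meas[OF A] by (rule M2.borel_measurable_nn_integral)
    have "(\<integral>\<^sup>+g. (\<integral>\<^sup>+x. indicator A x * (f g x / F x) \<partial>\<mu>) \<partial>l)
        = (\<integral>\<^sup>+x. (\<integral>\<^sup>+g. indicator A x * (f g x / F x) \<partial>l) \<partial>\<mu>)"
      by (rule Fubini'[OF pair_meas[OF A], symmetric])
    also have "\<dots> = (\<integral>\<^sup>+x. indicator A x \<partial>\<mu>)"
    proof (rule nn_integral_cong)
      fix x
      have "(\<integral>\<^sup>+g. indicator A x * (f g x / F x) \<partial>l) = indicator A x * (F x / F x)"
        unfolding F_def using slice[of x]
        by (subst nn_integral_cmult) (auto simp: nn_integral_divide)
      then show "(\<integral>\<^sup>+g. indicator A x * (f g x / F x) \<partial>l) = indicator A x"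
        using F_pos[of x] F_fin[of x] by (simp add: ennreal_divide_self less_top)
    qed
    also have "\<dots> = emeasure \<mu> A" using A by simp
    finally show "emeasure \<mu> A = (\<integral>\<^sup>+g. (\<integral>\<^sup>+x. indicator A (act g x) * H x \<partial>\<mu>) \<partial>l)"
      unfolding swap[OF A] ..
  next
    show "0 \<le> max 0 R" by simp
  qed
qed

text \<open>The Haar measure of the group elements moving \<open>x0\<close> into a ball is bounded independently of the
  centre, because every ball lies in a translate of a ball around \<open>x0\<close>.\<close>

lemma orbit_preimage_ball_bounded:
  "\<exists>V\<ge>0. \<forall>y. emeasure l {g. d (act g x0) y \<le> r} \<le> ennreal V"
proof -
  obtain D where D: "D \<ge> 0" "\<And>x. \<exists>g. d (act g x0) x \<le> D"
    using orbit_coarsely_dense[of x0] by blast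
  show ?thesis
  proof (intro exI[of _ "enn2real (emeasure l (orbit_ball (r + D)))"] conjI allI)
    fix y
    obtain k where k: "d (act k x0) y \<le> D" using D(2) by blast
    have "g \<in> (+) k ` orbit_ball (r + D)" if "d (act g x0) y \<le> r" for g
    proof -
      have "- k + g \<in> orbit_ball (r + D)"
        unfolding orbit_ball_def using that k triangle[of "act k x0" y "act g x0"] commute[of y "act g x0"]
        by (simp add: d_act_minus)
      then show ?thesis by (rule image_eqI[rotated]) (simp add: add.assoc[symmetric])
    qed
    then have sub: "{g. d (act g x0) y \<le> r} \<subseteq> (+) k ` orbit_ball (r + D)" by blast
    have "(+) k ` orbit_ball (r + D) = (\<lambda>g. - k + g) -` orbit_ball (r + D) \<inter> space borel"
      by (force simp: image_iff add.assoc[symmetric])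
    moreover have "(\<lambda>g. - k + g) \<in> measurable borel (borel :: 'g measure)"
      by (intro borel_measurable_continuous_onI continuous_intros)
    ultimately have "(+) k ` orbit_ball (r + D) \<in> sets l"
      using orbit_ball_measurable[of "r + D"] measurable_sets unfolding sets_l by metis
    then have "emeasure l {g. d (act g x0) y \<le> r} \<le> emeasure l ((+) k ` orbit_ball (r + D))"
      by (intro emeasure_mono sub)
    also have "\<dots> = emeasure l (orbit_ball (r + D))"
      by (rule l_translate[OF orbit_ball_measurable])
    also have "\<dots> = ennreal (enn2real (emeasure l (orbit_ball (r + D))))"
      using orbit_ball_finite by simp
    finally show "emeasure l {g. d (act g x0) y \<le> r}
        \<le> ennreal (enn2real (emeasure l (orbit_ball (r + D))))" .
  qed simp
qed

section \<open>Measure scaling of the orbit map\<close>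

text \<open>With \<open>H\<close> from \<open>exists_averaging_function\<close>, let \<open>\<Phi> A g\<close> be the integral of \<open>H\<close> over \<open>- g \<cdot> A\<close> and
  \<open>c = \<integral> H\<close>. Since \<open>H\<close> is supported in the ball of radius \<open>R\<close> around \<open>x0\<close>,
  \<open>\<Phi> A g\<close> equals \<open>c\<close> or \<open>0\<close>, according to whether \<open>g \<cdot> x0\<close> lies in \<open>A\<close>, unless the ball of radius \<open>R\<close> around
  \<open>g \<cdot> x0\<close> meets both \<open>A\<close> and its complement. As \<open>\<Phi> A\<close> integrates to the measure of \<open>A\<close>, the
  scaling factor is \<open>1 / c\<close>, and the error is at most the Haar measure of the exceptional set.
  The latter is covered by the preimages of boundedly large balls around a separated net in the
  \<open>2\<close>-boundary of \<open>A\<close>.\<close>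

proposition quasi_to_one_orbit_map: "\<exists>\<kappa>>0. quasi_to_one \<kappa> l d \<mu> (\<lambda>g. act g x0)"
proof -
  obtain H :: "'x \<Rightarrow> ennreal" and R where H_meas: "H \<in> borel_measurable \<mu>" and R: "R \<ge> 0"
    and support: "\<forall>x. H x \<noteq> 0 \<longrightarrow> d x0 x \<le> R"
    and average: "\<forall>A\<in>sets \<mu>. (\<lambda>g. \<integral>\<^sup>+x. indicator A (act g x) * H x \<partial>\<mu>) \<in> borel_measurable l \<and>
      emeasure \<mu> A = (\<integral>\<^sup>+g. (\<integral>\<^sup>+x. indicator A (act g x) * H x \<partial>\<mu>) \<partial>l)"
    using exists_averaging_function by (elim exE conjE) (rule that)
  define \<Phi> where "\<Phi> A g = (\<integral>\<^sup>+x. indicator A (act g x) * H x \<partial>\<mu>)" for A g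
  have \<Phi>_meas: "\<Phi> A \<in> borel_measurable l" and \<Phi>_int: "emeasure \<mu> A = integral\<^sup>N l (\<Phi> A)"
    if "A \<in> sets \<mu>" for A
    using average that unfolding \<Phi>_def by simp_all
  define c where "c = integral\<^sup>N \<mu> H"
  have \<Phi>_le: "\<Phi> A g \<le> c" for A g
    unfolding \<Phi>_def c_def by (intro nn_integral_mono) (auto simp: indicator_def)
  have \<Phi>_inside: "\<Phi> A g = c" if "mcball (act g x0) R \<subseteq> A" for A g
    unfolding \<Phi>_def c_def
  proof (intro nn_integral_cong)
    fix x
    show "indicator A (act g x) * H x = H x"
    proof (cases "H x = 0")
      case False
      then have "act g x \<in> A" using support that by (intro subsetD[OF that]) simp
      then show ?thesis by simp
    qed simp
  qed
  have \<Phi>_outside: "\<Phi> A g = 0" if "mcball (act g x0) R \<inter> A = {}" for A g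
  proof -
    have "indicator A (act g x) * H x = 0" for x
    proof (cases "H x = 0")
      case False
      then have "act g x \<in> mcball (act g x0) R" using support by simp
      then have "act g x \<notin> A" using that by blast
      then show ?thesis by simp
    qed simp
    then show ?thesis unfolding \<Phi>_def by (simp only: nn_integral_const mult_zero_left)
  qed
  \<comment> \<open>Compare with the finite measure of a ball so large that \<open>\<Phi>\<close> equals \<open>c\<close> on a set of positive measure.\<close>
  have c_fin: "c < \<infinity>"
  proof -
    obtain r where r: "0 < emeasure l (orbit_ball r)" using orbit_ball_pos by blast
    let ?A = "mcball x0 (r + R)"
    have "c * indicator (orbit_ball r) g \<le> \<Phi> ?A g" for g
    proof (cases "g \<in> orbit_ball r")
      case True
      then have "d (act g x0) x0 + R \<le> r + R" unfolding orbit_ball_def using commute by simp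
      then have "mcball (act g x0) R \<subseteq> ?A" by (intro mcball_subset) simp_all
      then show ?thesis using \<Phi>_inside True by simp
    qed simp
    then have "(\<integral>\<^sup>+g. c * indicator (orbit_ball r) g \<partial>l) \<le> integral\<^sup>N l (\<Phi> ?A)"
      by (intro nn_integral_mono)
    then have "c * emeasure l (orbit_ball r) \<le> emeasure \<mu> ?A"
      using \<Phi>_int[OF closed_ball_measurable]
      by (simp add: nn_integral_cmult_indicator orbit_ball_measurable)
    also have "\<dots> < \<infinity>" by (rule ball_measure_finite)
    finally have "c * emeasure l (orbit_ball r) < \<infinity>" .
    then show ?thesis using r by (auto simp: ennreal_mult_less_top)
  qed
  \<comment> \<open>Otherwise \<open>\<Phi>\<close> would vanish, and with it the measure of the whole space.\<close>
  have "c \<noteq> 0"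
  proof
    assume "c = 0"
    then have "\<Phi> (space \<mu>) = (\<lambda>_. 0)" using \<Phi>_le[of "space \<mu>"] by (intro ext) simp
    then have "emeasure \<mu> (space \<mu>) = 0" using \<Phi>_int[of "space \<mu>"] by simp
    then show False
      using standard unfolding standard_mm_space_def metric_measure_space_def by blast
  qed
  with c_fin obtain \<gamma> where \<gamma>: "c = ennreal \<gamma>" "\<gamma> > 0"
    by (cases c) (auto simp: less_le)
  obtain V where V: "V \<ge> 0" "\<And>y. emeasure l {g. d (act g x0) y \<le> 3 * R + 2} \<le> ennreal V"
    using orbit_preimage_ball_bounded[of "3 * R + 2"] by blast
  obtain v where v: "v > 0" "\<And>x. ennreal v \<le> emeasure \<mu> (mcball x 1)"
    using standard unfolding standard_mm_space_def by (metis order_refl)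
  have "\<bar>ereal (1 / \<gamma>) * enn2ereal (emeasure \<mu> A)
        - enn2ereal (emeasure l ((\<lambda>g. act g x0) -` A \<inter> space l))\<bar>
      \<le> ereal (V / v + 1) * enn2ereal (outer_measure_of \<mu> (boundary d 2 A))"
    if A: "A \<in> sets \<mu>" "emeasure \<mu> A < \<infinity>" for A
  proof (cases "outer_measure_of \<mu> (boundary d 2 A) < \<infinity>")
    case False
    then have "outer_measure_of \<mu> (boundary d 2 A) = \<infinity>" by (simp add: not_less top_unique)
    moreover have "V / v + 1 > 0" using V(1) v(1) by (simp add: add_nonneg_pos)
    ultimately show ?thesis by simp
  next
    case True
    then obtain b where b: "outer_measure_of \<mu> (boundary d 2 A) = ennreal b" "b \<ge> 0"
      by (cases "outer_measure_of \<mu> (boundary d 2 A)") auto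
    obtain N where N: "finite N" "of_nat (card N) * ennreal v \<le> ennreal b"
      "\<And>y. mcball y 1 \<subseteq> boundary d 2 A \<Longrightarrow> \<exists>n\<in>N. d y n \<le> 2"
      using separated_net[OF v True] b by metis
    define E where "E = (\<lambda>g. act g x0) -` A \<inter> space l"
    have E: "E \<in> sets l" unfolding E_def by (rule measurable_sets[OF measurable_orbit_map A(1)])
    have ball_preimage: "{g. d (act g x0) y \<le> r} \<in> sets l" for y r
    proof -
      have "{g. d (act g x0) y \<le> r} = (\<lambda>g. act g x0) -` mcball y r \<inter> space l"
        by (auto simp: space_l commute)
      then show ?thesis
        using measurable_sets[OF measurable_orbit_map closed_ball_measurable] by simp
    qed
    define W where "W = (\<Union>n\<in>N. {g. d (act g x0) n \<le> 3 * R + 2})"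
    have W: "W \<in> sets l" unfolding W_def using N(1) ball_preimage by blast
    \<comment> \<open>The net has at most \<open>b / v\<close> points, each contributing at most \<open>V\<close>.\<close>
    have "emeasure l W \<le> (\<Sum>n\<in>N. emeasure l {g. d (act g x0) n \<le> 3 * R + 2})"
      unfolding W_def using N(1) ball_preimage by (intro emeasure_subadditive_finite) auto
    also have "\<dots> \<le> (\<Sum>n\<in>N. ennreal V)" using V(2) by (intro sum_mono)
    also have "\<dots> = ennreal (real (card N) * V)"
      using V(1) by (simp add: ennreal_mult ennreal_of_nat_eq_real_of_nat)
    also have "\<dots> \<le> ennreal (b / v * V)"
    proof -
      have "ennreal (real (card N) * v) \<le> ennreal b"
        using N(2) v(1) by (simp add: ennreal_mult ennreal_of_nat_eq_real_of_nat)
      then have "real (card N) \<le> b / v" using b(2) v(1) by (simp add: pos_le_divide_eq)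
      then show ?thesis using V(1) by (intro ennreal_leI mult_right_mono)
    qed
    finally have W_le: "emeasure l W \<le> ennreal (b / v * V)" .
    then have "emeasure l W < \<infinity>" by (simp add: order_le_less_trans)
    then obtain w where w: "emeasure l W = ennreal w" "w \<ge> 0" by (cases "emeasure l W") auto
    have w_le: "w \<le> b / v * V" using W_le w b(2) v(1) V(1) by simp
    have near_boundary: "g \<in> W"
      if pq: "p \<in> mcball (act g x0) R" "q \<in> mcball (act g x0) R" "p \<in> A" "q \<notin> A" for g p q
    proof -
      obtain y where y: "mcball y 1 \<subseteq> boundary d 2 A" "d (act g x0) y \<le> 3 * R"
        using crossing_point[of p A q "act g x0" R] pq by auto
      obtain n where n: "n \<in> N" "d y n \<le> 2" using N(3)[OF y(1)] by blast
      have "d (act g x0) n \<le> 3 * R + 2" using triangle[of "act g x0" y n] y(2) n(2) by simp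
      then show ?thesis unfolding W_def using n(1) by blast
    qed
    have centre: "act g x0 \<in> mcball (act g x0) R" for g using R by simp
    have \<Phi>_eq: "\<Phi> A g = c * indicator E g" if "g \<notin> W" for g
    proof (cases "act g x0 \<in> A")
      case True
      then have "mcball (act g x0) R \<subseteq> A"
        using near_boundary[OF centre _ True] \<open>g \<notin> W\<close> by blast
      then show ?thesis using \<Phi>_inside True by (simp add: E_def space_l)
    next
      case False
      then have "mcball (act g x0) R \<inter> A = {}"
        using near_boundary[OF _ centre _ False] \<open>g \<notin> W\<close> by blast
      then show ?thesis using \<Phi>_outside False by (simp add: E_def)
    qed
    have upper: "\<Phi> A g \<le> c * indicator E g + c * indicator W g" for g
      using \<Phi>_eq[of g] \<Phi>_le[of A g] by (cases "g \<in> W") (auto simp: indicator_def add_increasing)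
    have lower: "c * indicator E g \<le> \<Phi> A g + c * indicator W g" for g
      using \<Phi>_eq[of g] by (cases "g \<in> W") (auto simp: indicator_def)
    have "emeasure \<mu> A \<le> (\<integral>\<^sup>+g. c * indicator E g + c * indicator W g \<partial>l)"
      unfolding \<Phi>_int[OF A(1)] by (intro nn_integral_mono upper)
    also have "\<dots> = c * emeasure l E + c * emeasure l W"
      using E W by (subst nn_integral_add) (auto simp: nn_integral_cmult_indicator)
    finally have upper_int: "emeasure \<mu> A \<le> c * emeasure l E + c * emeasure l W" .
    have "c * emeasure l E = (\<integral>\<^sup>+g. c * indicator E g \<partial>l)"
      using E by (simp add: nn_integral_cmult_indicator)
    also have "\<dots> \<le> (\<integral>\<^sup>+g. \<Phi> A g + c * indicator W g \<partial>l)"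
      by (intro nn_integral_mono lower)
    also have "\<dots> = emeasure \<mu> A + c * emeasure l W"
      using W \<Phi>_meas[OF A(1)] unfolding \<Phi>_int[OF A(1)]
      by (subst nn_integral_add) (auto simp: nn_integral_cmult_indicator)
    finally have lower_int: "c * emeasure l E \<le> emeasure \<mu> A + c * emeasure l W" .
    obtain m where m: "emeasure \<mu> A = ennreal m" "m \<ge> 0"
      using A(2) by (cases "emeasure \<mu> A") auto
    have "c * emeasure l E < \<infinity>"
      using lower_int unfolding m w \<gamma> by (rule order_le_less_trans) (simp add: ennreal_mult_less_top)
    then have "emeasure l E < \<infinity>" using \<gamma> by (auto simp: ennreal_mult_less_top)
    then obtain e where e: "emeasure l E = ennreal e" "e \<ge> 0" by (cases "emeasure l E") auto
    have "m \<le> \<gamma> * e + \<gamma> * w" "\<gamma> * e \<le> m + \<gamma> * w"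
      using upper_int lower_int \<gamma>(2) m(2) w(2) e(2) unfolding m w \<gamma> e
      by (simp_all flip: ennreal_mult ennreal_plus)
    then have "\<bar>m / \<gamma> - e\<bar> \<le> w"
      using \<gamma>(2) by (simp add: abs_le_iff field_simps)
    also have "w \<le> (V / v + 1) * b"
      using w_le b(2) by (simp add: algebra_simps)
    finally show ?thesis
      unfolding E_def[symmetric] m b(1) e using m(2) b(2) e(2) by simp
  qed
  \<comment> \<open>The summand \<open>1\<close> keeps the constant positive even if \<open>V = 0\<close>.\<close>
  moreover have "V / v + 1 > 0" using V(1) v(1) by (simp add: add_nonneg_pos)
  ultimately have "quasi_to_one (1 / \<gamma>) l d \<mu> (\<lambda>g. act g x0)"
    unfolding quasi_to_one_def using measurable_orbit_map by blast
  moreover have "1 / \<gamma> > 0" using \<gamma>(2) by simp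
  ultimately show ?thesis by blast
qed

end

section \<open>Compact generation and measure-scaling quasi-isometries\<close>

theorem theorem5p1:
  fixes d :: "'x::t2_space \<Rightarrow> 'x \<Rightarrow> real"
    and \<mu> :: "'x measure"
    and act :: "'g::{topological_group_add, t2_space} \<Rightarrow> 'x \<Rightarrow> 'x"
  assumes X: "standard_mm_space d \<mu>"
    and compatible: "compact_sets_bounded d"
    and G: "locally_compact_space (euclidean :: 'g topology)"
    and action: "continuous_group_action act"
    and mp_isometries: "acts_by_mp_isometries act d \<mu>"
    and proper: "proper_action act"
    and cocompact: "cocompact_action act"
  shows "(\<exists>S :: 'g set. compact S \<and> generates S) \<and>
    (\<forall>(S :: 'g set) (l :: 'g measure).
       compact S \<and> generates S \<and> left_haar_measure l \<longrightarrow>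
         (interior S \<noteq> {} \<longrightarrow> standard_mm_space (word_metric S) l) \<and>
         (\<forall>x0. measure_scaling_quasi_isometry (word_metric S) l d \<mu> (\<lambda>g. act g x0)))"
proof -
  interpret proper_cocompact_action d \<mu> act
    using assms by unfold_locales
  show ?thesis
  proof (intro conjI allI impI)
    show "\<exists>S :: 'g set. compact S \<and> generates S" by (rule compactly_generated)
    fix S :: "'g set" and l :: "'g measure" and x0 :: 'x
    assume "compact S \<and> generates S \<and> left_haar_measure l"
    then have S: "compact S" "generates S" and l: "left_haar_measure l" by blast+
    show "standard_mm_space (word_metric S) l" if "interior S \<noteq> {}"
      by (rule standard_mm_space_word_metric[OF G S that l])
    interpret proper_cocompact_action_haar d \<mu> act l x0
      by unfold_locales (rule l)
    show "measure_scaling_quasi_isometry (word_metric S) l d \<mu> (\<lambda>g. act g x0)"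
      unfolding measure_scaling_quasi_isometry_def
      using measurable_orbit_map quasi_isometry_orbit_map[OF S] quasi_to_one_orbit_map by blast
  qed
qed

end
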